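(* Let $\begin{bmatrix}A&B\\C&D\end{bmatrix}\in\mathbb H^{(n+1)\times(n+1)}$ be a unitary matrix with $D\in\mathbb H$, $A\in\mathbb H^{n\times n}$ and $\sigma_{\bf r}(A)\subset\mathbb B_1$. Then the power series $$f(z)=D+zC(I-zA)^{-1}B=D+\sum_{k=1}^\infty z^kCA^{k-1}B$$ is a Blaschke product of degree $n$. Conversely, any finite Blaschke product $f$ admits a stable unitary realization of this form, i.e. $f(z)=D+zC(I-zA)^{-1}B$ for some unitary quaternionic matrix $\begin{bmatrix}A&B\\C&D\end{bmatrix}$ with $D\in\mathbb H$, $A$ square and $\sigma_{\bf r}(A)\subset\mathbb B_1$.
   Context: $\mathbb H$ is the skew field of real quaternions with conjugation $\alpha\mapsto\overline\alpha$ and modulus $|\cdot|$; $\mathbb B_1=\{\alpha\in\mathbb H:|\alpha|<1\}$. Formal power series have coefficients in $\mathbb H$ and a variable $z$ commuting with the coefficients, with the Cauchy product $(fg)_k=\sum_{\ell=0}^kf_\ell g_{k-\ell}$. A quaternionic matrix $U$ is unitary if $UU^*=U^*U=I$, where ${}^*$ is the conjugate transpose. $\sigma_{\bf r}(A)$ is the set of right eigenvalues of $A$: those $\alpha\in\mathbb H$ with $A{\bf x}={\bf x}\alpha$ for some nonzero column ${\bf x}\in\mathbb H^{n\times 1}$; $A$ is called stable if $\sigma_{\bf r}(A)\subset\mathbb B_1$. For $\alpha\in\mathbb B_1$, the Blaschke factor is ${\bf b}_\alpha(z)=(z-\alpha)\sum_{k\ge0}\overline\alpha^kz^k$. A finite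 Blaschke product of degree $n\ge0$ is a power series ${\bf b}_{\alpha_1}\cdots{\bf b}_{\alpha_n}\phi$ with $\alpha_1,\dots,\alpha_n\in\mathbb B_1$ and $\phi\in\mathbb H$, $|\phi|=1$ (unimodular constants have degree $0$). *)

theory Defs
  imports
    "HOL-Analysis.Inner_Product"
    "HOL-Computational_Algebra.Formal_Power_Series"
    "Jordan_Normal_Form.Matrix"
begin

section \<open>The skew field of real quaternions\<close>

codatatype quat = Quat (Req: real) (Imi: real) (Imj: real) (Imk: real)

lemma quat_eq_iff:
  "x = y \<longleftrightarrow> Req x = Req y \<and> Imi x = Imi y \<and> Imj x = Imj y \<and> Imk x = Imk y"
  by (auto intro: quat.expand)

instantiation quat :: ab_group_add
begin

primcorec zero_quat where
  "Req 0 = 0" | "Imi 0 = 0" | "Imj 0 = 0" | "Imk 0 = 0"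

primcorec plus_quat where
  "Req (x + y) = Req x + Req y"
| "Imi (x + y) = Imi x + Imi y"
| "Imj (x + y) = Imj x + Imj y"
| "Imk (x + y) = Imk x + Imk y"

primcorec uminus_quat where
  "Req (- x) = - Req x"
| "Imi (- x) = - Imi x"
| "Imj (- x) = - Imj x"
| "Imk (- x) = - Imk x"

primcorec minus_quat where
  "Req (x - y) = Req x - Req y"
| "Imi (x - y) = Imi x - Imi y"
| "Imj (x - y) = Imj x - Imj y"
| "Imk (x - y) = Imk x - Imk y"

instance
  by standard (simp_all add: quat_eq_iff)

end

instantiation quat :: ring_1
begin

primcorec one_quat where
  "Req 1 = 1" | "Imi 1 = 0" | "Imj 1 = 0" | "Imk 1 = 0"

primcorec times_quat where
  "Req (x * y) = Req x * Req y - Imi x * Imi y - Imj x * Imj y - Imk x * Imk y"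
| "Imi (x * y) = Req x * Imi y + Imi x * Req y + Imj x * Imk y - Imk x * Imj y"
| "Imj (x * y) = Req x * Imj y - Imi x * Imk y + Imj x * Req y + Imk x * Imi y"
| "Imk (x * y) = Req x * Imk y + Imi x * Imj y - Imj x * Imi y + Imk x * Req y"

instance
  by standard (simp_all add: quat_eq_iff algebra_simps)

end

primcorec qcnj :: "quat \<Rightarrow> quat" where
  "Req (qcnj x) = Req x"
| "Imi (qcnj x) = - Imi x"
| "Imj (qcnj x) = - Imj x"
| "Imk (qcnj x) = - Imk x"

instantiation quat :: real_algebra_1
begin

primcorec scaleR_quat where
  "Req (scaleR r x) = r * Req x"
| "Imi (scaleR r x) = r * Imi x"
| "Imj (scaleR r x) = r * Imj x"
| "Imk (scaleR r x) = r * Imk x"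

instance
  by standard (simp_all add: quat_eq_iff algebra_simps)

end

instantiation quat :: real_inner
begin

definition inner_quat :: "quat \<Rightarrow> quat \<Rightarrow> real" where
  "inner_quat x y = Req x * Req y + Imi x * Imi y + Imj x * Imj y + Imk x * Imk y"

definition norm_quat :: "quat \<Rightarrow> real" where
  "norm_quat x = sqrt ((Req x)\<^sup>2 + (Imi x)\<^sup>2 + (Imj x)\<^sup>2 + (Imk x)\<^sup>2)"

definition sgn_quat :: "quat \<Rightarrow> quat" where
  "sgn_quat x = x /\<^sub>R norm x"

definition dist_quat :: "quat \<Rightarrow> quat \<Rightarrow> real" where
  "dist_quat x y = norm (x - y)"

definition uniformity_quat :: "(quat \<times> quat) filter" where
  "uniformity_quat = (INF e\<in>{0 <..}. principal {(x, y). dist x y < e})"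

definition open_quat :: "quat set \<Rightarrow> bool" where
  "open_quat U \<longleftrightarrow> (\<forall>x\<in>U. eventually (\<lambda>(x', y). x' = x \<longrightarrow> y \<in> U) uniformity)"

instance
proof
  fix r :: real and x y z :: quat
  have nonneg: "0 \<le> inner x x"
    by (simp add: inner_quat_def)
  then show "0 \<le> inner x x" .
  show "inner x x = 0 \<longleftrightarrow> x = 0"
    by (simp add: inner_quat_def quat_eq_iff add_nonneg_eq_0_iff)
  show "norm x = sqrt (inner x x)"
    by (simp add: inner_quat_def norm_quat_def power2_eq_square)
qed (simp_all add: inner_quat_def sgn_quat_def dist_quat_def uniformity_quat_def open_quat_def
      algebra_simps)

end

instantiation quat :: real_normed_div_algebra
begin

definition inverse_quat :: "quat \<Rightarrow> quat" where
  "inverse_quat x = qcnj x /\<^sub>R (norm x)\<^sup>2"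

definition divide_quat :: "quat \<Rightarrow> quat \<Rightarrow> quat" where
  "divide_quat x y = x * inverse y"

lemma norm_quat_power2: "(norm x)\<^sup>2 = (Req x)\<^sup>2 + (Imi x)\<^sup>2 + (Imj x)\<^sup>2 + (Imk x)\<^sup>2" for x :: quat
  by (simp add: norm_quat_def)

lemma quat_mult_qcnj: "x * qcnj x = of_real ((norm x)\<^sup>2)"
  unfolding norm_quat_power2 of_real_def
  by (simp add: quat_eq_iff power2_eq_square algebra_simps)

lemma qcnj_mult_quat: "qcnj x * x = of_real ((norm x)\<^sup>2)"
  unfolding norm_quat_power2 of_real_def
  by (simp add: quat_eq_iff power2_eq_square algebra_simps)

instance
proof
  fix x y :: quat
  show "x \<noteq> 0 \<Longrightarrow> inverse x * x = 1"
    by (simp add: inverse_quat_def qcnj_mult_quat of_real_def)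
  show "x \<noteq> 0 \<Longrightarrow> x * inverse x = 1"
    by (simp add: inverse_quat_def quat_mult_qcnj of_real_def)
  show "x div y = x * inverse y"
    by (simp add: divide_quat_def)
  show "inverse (0::quat) = 0"
    by (simp add: inverse_quat_def)
  show "norm (x * y) = norm x * norm y"
    by (simp add: norm_quat_def real_sqrt_mult [symmetric] power2_eq_square algebra_simps)
qed

end


section \<open>Quaternionic matrices\<close>

definition qadjoint :: "quat mat \<Rightarrow> quat mat" where
  "qadjoint M = map_mat qcnj (transpose_mat M)"

definition qunitary :: "nat \<Rightarrow> quat mat \<Rightarrow> bool" where
  "qunitary n U \<longleftrightarrow> U \<in> carrier_mat n n \<and> U * qadjoint U = 1\<^sub>m n \<and> qadjoint U * U = 1\<^sub>m n"

text \<open>The eigenvalue acts from the right, so the library's left scalar multiple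
  \<open>\<cdot>\<^sub>v\<close> does not apply.\<close>

definition right_eigenvalues :: "quat mat \<Rightarrow> quat set" where
  "right_eigenvalues A =
    {\<alpha>. \<exists>x \<in> carrier_vec (dim_row A). x \<noteq> 0\<^sub>v (dim_row A) \<and> A *\<^sub>v x = map_vec (\<lambda>t. t * \<alpha>) x}"

definition stable :: "quat mat \<Rightarrow> bool" where
  "stable A \<longleftrightarrow> right_eigenvalues A \<subseteq> {\<alpha>. norm \<alpha> < 1}"

definition colligation :: "quat mat \<Rightarrow> quat mat \<Rightarrow> quat mat \<Rightarrow> quat \<Rightarrow> quat mat" where
  "colligation A B C D = four_block_mat A B C (mat 1 1 (\<lambda>_. D))"

definition stable_unitary ::
    "nat \<Rightarrow> quat mat \<Rightarrow> quat mat \<Rightarrow> quat mat \<Rightarrow> quat \<Rightarrow> bool" where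
  "stable_unitary n A B C D \<longleftrightarrow>
    A \<in> carrier_mat n n \<and> B \<in> carrier_mat n 1 \<and> C \<in> carrier_mat 1 n \<and>
    qunitary (n + 1) (colligation A B C D) \<and> stable A"


section \<open>Realizations\<close>

text \<open>The two-sided inverse of a square matrix over a possibly noncommutative ring
  (unspecified if the matrix is not invertible).\<close>

definition mat_inv :: "'a :: ring_1 mat \<Rightarrow> 'a mat" where
  "mat_inv M =
    (THE R. R \<in> carrier_mat (dim_row M) (dim_row M) \<and> inverts_mat M R \<and> inverts_mat R M)"

lemma mat_inv_eqI:
  assumes M: "M \<in> carrier_mat n n" and R: "R \<in> carrier_mat n n"
    and MR: "M * R = 1\<^sub>m n" and RM: "R * M = 1\<^sub>m n"
  shows "mat_inv M = R"
  unfolding mat_inv_def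
proof (rule the_equality)
  show "R \<in> carrier_mat (dim_row M) (dim_row M) \<and> inverts_mat M R \<and> inverts_mat R M"
    using assms by (auto simp: inverts_mat_def)
  fix S assume "S \<in> carrier_mat (dim_row M) (dim_row M) \<and> inverts_mat M S \<and> inverts_mat S M"
  then have S: "S \<in> carrier_mat n n" and SM: "S * M = 1\<^sub>m n"
    using M by (auto simp: inverts_mat_def)
  have "S = S * (M * R)"
    using S MR by simp
  also have "\<dots> = (S * M) * R"
    using S M R by (simp add: assoc_mult_mat[of _ n n _ n _ n])
  also have "\<dots> = R"
    using SM R by simp
  finally show "S = R" .
qed

text \<open>\<open>D + zC(I - zA)\<^sup>-\<^sup>1B\<close>, computed with matrices over the ring of formal power series;
  \<open>fps_X\<close> is the central variable \<open>z\<close>, and the \<open>1 \<times> 1\<close> matrix is identified with its entry.\<close>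

definition realization_fun :: "quat mat \<Rightarrow> quat mat \<Rightarrow> quat mat \<Rightarrow> quat \<Rightarrow> quat fps" where
  "realization_fun A B C D =
    fps_const D + fps_X *
      (map_mat fps_const C *
       mat_inv (1\<^sub>m (dim_row A) - fps_X \<cdot>\<^sub>m map_mat fps_const A) *
       map_mat fps_const B) $$ (0, 0)"

definition realization_series :: "quat mat \<Rightarrow> quat mat \<Rightarrow> quat mat \<Rightarrow> quat \<Rightarrow> quat fps" where
  "realization_series A B C D =
    Abs_fps (\<lambda>k. if k = 0 then D else (C * (A ^\<^sub>m (k - 1)) * B) $$ (0, 0))"


section \<open>Finite Blaschke products\<close>

definition blaschke_factor :: "quat \<Rightarrow> quat fps" where
  "blaschke_factor \<alpha> = (fps_X - fps_const \<alpha>) * Abs_fps (\<lambda>k. qcnj \<alpha> ^ k)"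

definition blaschke_product :: "nat \<Rightarrow> quat fps \<Rightarrow> bool" where
  "blaschke_product n f \<longleftrightarrow>
    (\<exists>\<alpha>s \<phi>. length \<alpha>s = n \<and> (\<forall>\<alpha>\<in>set \<alpha>s. norm \<alpha> < 1) \<and> norm \<phi> = 1 \<and>
      f = prod_list (map blaschke_factor \<alpha>s) * fps_const \<phi>)"

end

theory Submission
  imports Defs "Jordan_Normal_Form.Spectral_Radius"
begin

text \<open>A Blaschke factor is realized by a unitary \<open>2 \<times> 2\<close> colligation, and feeding the output of a second
  colligation into it multiplies the power series by the factor on the left. This cascade
  is unitary if and only if the second colligation is, and likewise for stability, so products of
  Blaschke factors are realizable. Conversely, an eigenvector \<open>x\<close> of \<open>A\<close>, scaled so that it has
  norm one and \<open>C x\<close> is a nonnegative real, can be completed to a unitary change of the state space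
  taking it to the first basis vector. The first column of the new colligation is then that of
  a cascade, and unitarity forces the other entries to have the cascade form, so a Blaschke factor splits
  off and the state dimension drops by one.\<close>

section \<open>Quaternion conjugation, adjoints and unitary matrices\<close>

lemma qcnj_qcnj [simp]: "qcnj (qcnj x) = x"
  by (simp add: quat_eq_iff)

lemma qcnj_0 [simp]: "qcnj 0 = 0"
  by (simp add: quat_eq_iff)

lemma qcnj_1 [simp]: "qcnj 1 = 1"
  by (simp add: quat_eq_iff)

lemma qcnj_add [simp]: "qcnj (x + y) = qcnj x + qcnj y"
  by (simp add: quat_eq_iff)

lemma qcnj_minus [simp]: "qcnj (- x) = - qcnj x"
  by (simp add: quat_eq_iff)

lemma qcnj_diff [simp]: "qcnj (x - y) = qcnj x - qcnj y"
  by (simp add: quat_eq_iff)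

lemma qcnj_mult [simp]: "qcnj (x * y) = qcnj y * qcnj x"
  by (simp add: quat_eq_iff algebra_simps)

lemma qcnj_scaleR [simp]: "qcnj (r *\<^sub>R x) = r *\<^sub>R qcnj x"
  by (simp add: quat_eq_iff)

lemma qcnj_of_real [simp]: "qcnj (of_real r) = of_real r"
  by (simp add: of_real_def)

lemma qcnj_sum: "qcnj (sum f S) = (\<Sum>i\<in>S. qcnj (f i))"
  by (induction S rule: infinite_finite_induct) simp_all

lemma norm_qcnj [simp]: "norm (qcnj x) = norm x"
  by (simp add: norm_quat_def)

lemma qadjoint_carrier [simp]: "A \<in> carrier_mat m n \<Longrightarrow> qadjoint A \<in> carrier_mat n m"
  by (simp add: qadjoint_def)

lemma index_qadjoint [simp]:
  "i < dim_col A \<Longrightarrow> j < dim_row A \<Longrightarrow> qadjoint A $$ (i, j) = qcnj (A $$ (j, i))"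
  "dim_row (qadjoint A) = dim_col A" "dim_col (qadjoint A) = dim_row A"
  by (simp_all add: qadjoint_def)

lemma qadjoint_qadjoint [simp]: "qadjoint (qadjoint A) = A"
  by (rule eq_matI) simp_all

lemma qadjoint_mult:
  assumes "dim_col A = dim_row B"
  shows "qadjoint (A * B) = qadjoint B * qadjoint A"
  using assms by (intro eq_matI) (auto simp: scalar_prod_def qcnj_sum intro!: sum.cong)

lemma qunitary_qadjoint: "qunitary n U \<Longrightarrow> qunitary n (qadjoint U)"
  by (simp add: qunitary_def)

lemma qunitary_mult:
  assumes "qunitary n U" "qunitary n V"
  shows "qunitary n (U * V)"
proof -
  have U: "U \<in> carrier_mat n n" "U * qadjoint U = 1\<^sub>m n" "qadjoint U * U = 1\<^sub>m n"
    and V: "V \<in> carrier_mat n n" "V * qadjoint V = 1\<^sub>m n" "qadjoint V * V = 1\<^sub>m n"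
    using assms by (simp_all add: qunitary_def)
  have c: "qadjoint U \<in> carrier_mat n n" "qadjoint V \<in> carrier_mat n n"
    using U V by simp_all
  have adj: "qadjoint (U * V) = qadjoint V * qadjoint U"
    using U V by (intro qadjoint_mult) simp
  have "U * V * qadjoint (U * V) = U * (V * qadjoint V) * qadjoint U"
    unfolding adj using U(1) V(1) c by (simp add: assoc_mult_mat[of _ n n _ n _ n] mult_carrier_mat[of _ n n _ n])
  moreover have "qadjoint (U * V) * (U * V) = qadjoint V * (qadjoint U * U) * V"
    unfolding adj using U(1) V(1) c by (simp add: assoc_mult_mat[of _ n n _ n _ n] mult_carrier_mat[of _ n n _ n])
  ultimately show ?thesis
    using U V c by (simp add: qunitary_def)
qed

lemma mult_qadjoint_eq_1_iff:
  assumes "U \<in> carrier_mat n n"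
  shows "U * qadjoint U = 1\<^sub>m n \<longleftrightarrow>
    (\<forall>i<n. \<forall>j<n. (\<Sum>k<n. U $$ (i, k) * qcnj (U $$ (j, k))) = (if i = j then 1 else 0))"
  using assms by (auto simp: mat_eq_iff scalar_prod_def lessThan_atLeast0)

lemma qadjoint_mult_eq_1_iff:
  assumes "U \<in> carrier_mat n n"
  shows "qadjoint U * U = 1\<^sub>m n \<longleftrightarrow>
    (\<forall>i<n. \<forall>j<n. (\<Sum>k<n. qcnj (U $$ (k, i)) * U $$ (k, j)) = (if i = j then 1 else 0))"
  using assms by (auto simp: mat_eq_iff scalar_prod_def lessThan_atLeast0)

lemma qunitary_entries_iff:
  "qunitary n U \<longleftrightarrow> U \<in> carrier_mat n n \<and>
    (\<forall>i<n. \<forall>j<n. (\<Sum>k<n. U $$ (i, k) * qcnj (U $$ (j, k))) = (if i = j then 1 else 0)) \<and>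
    (\<forall>i<n. \<forall>j<n. (\<Sum>k<n. qcnj (U $$ (k, i)) * U $$ (k, j)) = (if i = j then 1 else 0))"
  unfolding qunitary_def using mult_qadjoint_eq_1_iff qadjoint_mult_eq_1_iff by blast

section \<open>Right eigenvectors of quaternionic matrices\<close>

text \<open>\<open>quat_of_pair u v\<close> is \<open>u + j v\<close>. Since \<open>v\<close> stands on the right of \<open>j\<close>, right multiplication
  by a complex number acts on \<open>u\<close> and \<open>v\<close> separately.\<close>

definition quat_of_pair :: "complex \<Rightarrow> complex \<Rightarrow> quat" where
  "quat_of_pair u v = Quat (Re u) (Im u) (Re v) (- Im v)"

definition fst_part :: "quat \<Rightarrow> complex" where
  "fst_part q = Complex (Req q) (Imi q)"

definition snd_part :: "quat \<Rightarrow> complex" where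
  "snd_part q = Complex (Imj q) (- Imk q)"

lemma parts_quat_of_pair [simp]: "fst_part (quat_of_pair u v) = u" "snd_part (quat_of_pair u v) = v"
  by (simp_all add: fst_part_def snd_part_def quat_of_pair_def)

lemma quat_eq_iff_parts: "p = q \<longleftrightarrow> fst_part p = fst_part q \<and> snd_part p = snd_part q"
  by (auto simp: fst_part_def snd_part_def quat_eq_iff)

lemma parts_zero [simp]: "fst_part 0 = 0" "snd_part 0 = 0"
  by (simp_all add: fst_part_def snd_part_def complex_eq_iff)

lemma parts_add:
  "fst_part (p + q) = fst_part p + fst_part q" "snd_part (p + q) = snd_part p + snd_part q"
  by (simp_all add: fst_part_def snd_part_def complex_eq_iff)

lemma parts_sum:
  "fst_part (sum f S) = (\<Sum>i\<in>S. fst_part (f i))" "snd_part (sum f S) = (\<Sum>i\<in>S. snd_part (f i))"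
  by (induction S rule: infinite_finite_induct) (simp_all add: parts_add)

lemma parts_mult:
  "fst_part (p * q) = fst_part p * fst_part q - cnj (snd_part p) * snd_part q"
  "snd_part (p * q) = snd_part p * fst_part q + cnj (fst_part p) * snd_part q"
  by (simp_all add: fst_part_def snd_part_def complex_eq_iff)

text \<open>In the splitting \<open>u + j v\<close>, left multiplication by \<open>A\<close> is
  linear for right multiplication by complex scalars, so it becomes a complex matrix of twice the
  size. Such a matrix has an eigenvector, since the complex field is algebraically closed.\<close>

lemma right_eigenvector_exists:
  fixes A :: "quat mat"
  assumes A: "A \<in> carrier_mat n n" and n: "n > 0"
  obtains x \<alpha> where "x \<in> carrier_vec n" "x \<noteq> 0\<^sub>v n" "A *\<^sub>v x = map_vec (\<lambda>t. t * \<alpha>) x"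
proof -
  \<comment> \<open>The blocks are read off from \<open>parts_mult\<close>.\<close>
  define M where "M = four_block_mat (map_mat fst_part A) (map_mat (\<lambda>q. - cnj (snd_part q)) A)
    (map_mat snd_part A) (map_mat (\<lambda>q. cnj (fst_part q)) A)"
  have M: "M \<in> carrier_mat (n + n) (n + n)"
    unfolding M_def using A by (intro four_block_carrier_mat) auto
  then obtain l where "eigenvalue M l"
    using spectrum_non_empty[OF M] n by (auto simp: spectrum_def)
  then obtain z where z: "z \<in> carrier_vec (n + n)" "z \<noteq> 0\<^sub>v (n + n)" and Mz: "M *\<^sub>v z = l \<cdot>\<^sub>v z"
    using M by (auto simp: eigenvalue_def eigenvector_def)
  define x where "x = vec n (\<lambda>i. quat_of_pair (z $ i) (z $ (n + i)))"
  have split: "(\<Sum>k<n + m. f k) = (\<Sum>k<n. f k) + (\<Sum>k<m. f (n + k))" for f :: "nat \<Rightarrow> complex" and m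
    by (induction m) (simp_all add: add.assoc)
  have Mz': "(\<Sum>k<n + n. M $$ (i, k) * z $ k) = l * z $ i" if "i < n + n" for i
    using arg_cong[OF Mz, of "\<lambda>v. v $ i"] that M z by (auto simp: scalar_prod_def lessThan_atLeast0)
  \<comment> \<open>\<open>quat_of_pair l 0\<close> is the complex eigenvalue seen as a quaternion.
    Rows \<open>i\<close> and \<open>n + i\<close> of the complex eigenvalue equation are the two
    parts of entry \<open>i\<close>.\<close>
  have "A *\<^sub>v x = map_vec (\<lambda>t. t * quat_of_pair l 0) x"
  proof (rule eq_vecI)
    fix i assume "i < dim_vec (map_vec (\<lambda>t. t * quat_of_pair l 0) x)"
    then have i: "i < n"
      by (simp add: x_def)
    have "(\<Sum>k<n. A $$ (i, k) * x $ k) = x $ i * quat_of_pair l 0"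
      using Mz'[of i] Mz'[of "n + i"] i A
      by (simp add: quat_eq_iff_parts parts_sum parts_mult split x_def M_def sum.distrib
          sum_subtractf sum_negf algebra_simps)
    then show "(A *\<^sub>v x) $ i = map_vec (\<lambda>t. t * quat_of_pair l 0) x $ i"
      using i A by (simp add: scalar_prod_def x_def lessThan_atLeast0)
  qed (use A in \<open>simp add: x_def\<close>)
  moreover have "x \<noteq> 0\<^sub>v n"
  proof
    assume *: "x = 0\<^sub>v n"
    have 1: "z $ i = 0 \<and> z $ (n + i) = 0" if "i < n" for i
      using arg_cong[OF *, of "\<lambda>v. v $ i"] that by (simp add: x_def quat_eq_iff_parts)
    have "z = 0\<^sub>v (n + n)"
    proof (rule eq_vecI)
      fix i assume "i < dim_vec (0\<^sub>v (n + n))"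
      then show "z $ i = 0\<^sub>v (n + n) $ i"
        using 1[of i] 1[of "i - n"] by (cases "i < n") auto
    qed (use z in auto)
    with z show False by simp
  qed
  ultimately show thesis
    using that[of x] by (simp add: x_def)
qed

section \<open>Unitary matrices with a prescribed first column\<close>

text \<open>With \<open>w = x + \<mu> e\<^sub>0\<close> and \<open>x\<^sub>0 = |x\<^sub>0| \<mu>\<close>, the reflection \<open>1 - 2 w w\<^sup>* / |w|\<^sup>2\<close> maps
  \<open>\<mu> e\<^sub>0\<close> to \<open>- x\<close>.\<close>

lemma qunitary_first_column:
  assumes x: "(\<Sum>i<n. (norm (x i))\<^sup>2) = 1"
  obtains V where "qunitary n V" "\<And>i. i < n \<Longrightarrow> V $$ (i, 0) = x i"
proof -
  have n: "n > 0"
    using x by (cases n) auto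
  \<comment> \<open>The phase of \<open>x 0\<close>; the default 1 keeps it unimodular when
    \<open>x 0\<close> vanishes.\<close>
  define \<mu> where "\<mu> = (if x 0 = 0 then 1 else sgn (x 0))"
  have \<mu>: "norm \<mu> = 1"
    by (simp add: \<mu>_def norm_sgn)
  have x0: "x 0 = norm (x 0) *\<^sub>R \<mu>"
    by (simp add: \<mu>_def sgn_div_norm)
  define w where "w = (\<lambda>i. x i + (if i = 0 then \<mu> else 0))"
  define N where "N = (\<Sum>i<n. (norm (w i))\<^sup>2)"
  define r where "r = 2 / N"
  \<comment> \<open>Both summands of \<open>w 0\<close> have the same phase, so nothing cancels and
    \<open>N\<close> is positive.\<close>
  have w0: "w 0 = (norm (x 0) + 1) *\<^sub>R \<mu>"
    by (subst w_def, subst x0) (simp add: scaleR_add_left)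
  have N: "N = 2 * (1 + norm (x 0))"
  proof -
    have "N = (norm (w 0))\<^sup>2 + (\<Sum>i\<in>{..<n} - {0}. (norm (x i))\<^sup>2)"
      unfolding N_def by (subst sum.remove[of _ 0]) (use n in \<open>auto simp: w_def\<close>)
    also have "(\<Sum>i\<in>{..<n} - {0}. (norm (x i))\<^sup>2) = 1 - (norm (x 0))\<^sup>2"
      using x n by (subst (asm) sum.remove[of _ 0]) auto
    also have "norm (w 0) = norm (x 0) + 1"
      by (simp add: w0 \<mu>)
    finally show ?thesis
      by (simp add: power2_eq_square algebra_simps)
  qed
  have Npos: "N > 0"
    unfolding N by (simp add: add_pos_nonneg)
  have ww: "(\<Sum>k<n. qcnj (w k) * w k) = of_real N"
    by (simp add: qcnj_mult_quat N_def)
  \<comment> \<open>The diagonal of a unitary factor: column 0 of \<open>H\<close> turns into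
    \<open>x\<close> only after right multiplication by \<mu>.\<close>
  define m where "m = (\<lambda>i::nat. if i = 0 then \<mu> else 1 :: quat)"
  have m: "qcnj (m i) * m i = 1" "m i * qcnj (m i) = 1" for i
    by (simp_all add: m_def \<mu> qcnj_mult_quat quat_mult_qcnj)
  \<comment> \<open>The negative of the reflection, which therefore maps
    \<open>\<mu> e\<^sub>0\<close> to \<open>x\<close>. It is hermitian and its own inverse, hence
    unitary.\<close>
  define H where "H = (\<lambda>i j. (r *\<^sub>R (w i * qcnj (w j))) - (if i = j then 1 else 0))"
  have HH: "(\<Sum>k<n. H i k * H k j) = (if i = j then 1 else 0)" if ij: "i < n" "j < n" for i j
  proof -
    have "(\<Sum>k<n. H i k * H k j) = (\<Sum>k<n. (r * r) *\<^sub>R (w i * (qcnj (w k) * w k) * qcnj (w j)))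
       - (\<Sum>k<n. if i = k then r *\<^sub>R (w k * qcnj (w j)) else 0)
       - (\<Sum>k<n. if k = j then r *\<^sub>R (w i * qcnj (w k)) else 0) + (\<Sum>k<n. if i = k then if k = j then 1 else 0 else 0)"
      unfolding sum_subtractf[symmetric] sum.distrib[symmetric]
      by (rule sum.cong) (auto simp: H_def algebra_simps)
    also have "(\<Sum>k<n. (r * r) *\<^sub>R (w i * (qcnj (w k) * w k) * qcnj (w j)))
       = (r * r) *\<^sub>R (w i * of_real N * qcnj (w j))"
      by (simp only: sum_distrib_left[symmetric] sum_distrib_right[symmetric] scaleR_right.sum[symmetric] ww)
    \<comment> \<open>As \<open>r * N = 2\<close>, the quadratic term cancels the two mixed
      terms.\<close>
    also have "\<dots> = (2 * r) *\<^sub>R (w i * qcnj (w j))"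
      using Npos by (simp add: of_real_def r_def)
    also have "\<dots> = r *\<^sub>R (w i * qcnj (w j)) + r *\<^sub>R (w i * qcnj (w j))"
      by (simp only: mult_2 scaleR_add_left)
    finally show ?thesis
      using ij by simp
  qed
  have Hcnj: "qcnj (H i j) = H j i" for i j
    by (simp add: H_def)
  define V where "V = mat n n (\<lambda>(i, j). H i j * m j)"
  have "qunitary n V"
    unfolding qunitary_entries_iff
  proof (intro conjI allI impI)
    fix i j assume ij: "i < n" "j < n"
    have "(\<Sum>k<n. V $$ (i, k) * qcnj (V $$ (j, k))) = (\<Sum>k<n. H i k * (m k * qcnj (m k)) * H k j)"
      using ij by (intro sum.cong) (simp_all only: V_def, simp_all add: Hcnj mult.assoc)
    then show "(\<Sum>k<n. V $$ (i, k) * qcnj (V $$ (j, k))) = (if i = j then 1 else 0)"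
      using ij by (simp add: m HH)
    have "(\<Sum>k<n. qcnj (V $$ (k, i)) * V $$ (k, j)) = qcnj (m i) * (\<Sum>k<n. H i k * H k j) * m j"
      using ij by (simp add: V_def Hcnj mult.assoc sum_distrib_left sum_distrib_right)
    then show "(\<Sum>k<n. qcnj (V $$ (k, i)) * V $$ (k, j)) = (if i = j then 1 else 0)"
      using ij by (simp add: m HH)
  qed (simp add: V_def)
  moreover have "V $$ (i, 0) = x i" if "i < n" for i
  proof -
    have "r * (norm (x 0) + 1) = 1"
      using Npos unfolding r_def N by (simp add: field_simps)
    moreover have "qcnj (w 0) * \<mu> = of_real (norm (x 0) + 1)"
      by (simp add: w0 qcnj_mult_quat \<mu> of_real_def)
    then have "w i * qcnj (w 0) * \<mu> = (norm (x 0) + 1) *\<^sub>R w i"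
      by (simp add: mult.assoc of_real_def)
    ultimately have "V $$ (i, 0) = w i - (if i = 0 then \<mu> else 0)"
      using that n by (simp add: V_def H_def m_def left_diff_distrib)
    then show ?thesis
      by (simp add: w_def)
  qed
  ultimately show thesis
    using that by blast
qed

section \<open>Realizations and their state sequences\<close>

text \<open>Powers are defined with the new factor on the right; the state recursion needs it on the
  left.\<close>

lemma pow_mat_Suc_left:
  fixes A :: "'a :: semiring_1 mat"
  assumes A: "A \<in> carrier_mat n n"
  shows "A ^\<^sub>m Suc k = A * A ^\<^sub>m k"
proof (induction k)
  case (Suc k)
  then have "A ^\<^sub>m Suc (Suc k) = (A * A ^\<^sub>m k) * A"
    by simp
  then show ?case
    using A by (simp add: assoc_mult_mat[of _ n n _ n _ n])
qed (use A in simp)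

text \<open>The geometric series of \<open>z A\<close>, taken entrywise as \<open>R\<close>, inverts
  \<open>I - z A\<close>. Both products are checked because \<open>mat_inv\<close> asks for a
  two-sided inverse.\<close>

lemma realization_fun_eq_series:
  assumes A: "A \<in> carrier_mat n n" and B: "B \<in> carrier_mat n 1" and C: "C \<in> carrier_mat 1 n"
  shows "realization_fun A B C D = realization_series A B C D"
proof -
  define R where "R = mat n n (\<lambda>(i, j). Abs_fps (\<lambda>k. (A ^\<^sub>m k) $$ (i, j)))"
  define P where "P = fps_X \<cdot>\<^sub>m map_mat fps_const A"
  have R: "R \<in> carrier_mat n n" and P: "P \<in> carrier_mat n n"
    using A by (simp_all add: R_def P_def)
  have Ak: "A ^\<^sub>m k \<in> carrier_mat n n" for k
    using A by simp
  \<comment> \<open>Multiplying the geometric series by \<open>P\<close> reproduces it without its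
    constant term, the identity matrix.\<close>
  have PR: "(P * R) $$ (i, j) = R $$ (i, j) - (if i = j then 1 else 0)" if "i < n" "j < n" for i j
  proof (rule fps_ext)
    fix k
    show "fps_nth ((P * R) $$ (i, j)) k = fps_nth (R $$ (i, j) - (if i = j then 1 else 0)) k"
    proof (cases k)
      case 0
      then show ?thesis
        using that A by (simp add: P_def R_def scalar_prod_def fps_sum_nth mult.assoc)
    next
      case (Suc l)
      have "fps_nth ((P * R) $$ (i, j)) k = (A * A ^\<^sub>m l) $$ (i, j)"
        using that A Ak[of l] Suc
        by (simp add: P_def R_def scalar_prod_def fps_sum_nth mult.assoc del: pow_mat.simps)
      then show ?thesis
        using that Suc by (simp add: R_def pow_mat_Suc_left[OF A, symmetric] del: pow_mat.simps)
    qed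
  qed
  have RP: "(R * P) $$ (i, j) = R $$ (i, j) - (if i = j then 1 else 0)" if "i < n" "j < n" for i j
  proof (rule fps_ext)
    fix k
    show "fps_nth ((R * P) $$ (i, j)) k = fps_nth (R $$ (i, j) - (if i = j then 1 else 0)) k"
    proof (cases k)
      case 0
      then show ?thesis
        using that A by (simp add: P_def R_def scalar_prod_def fps_sum_nth mult.assoc)
    next
      case (Suc l)
      have "fps_nth ((R * P) $$ (i, j)) k = (A ^\<^sub>m l * A) $$ (i, j)"
        using that A Ak[of l] Suc
        by (simp add: P_def R_def scalar_prod_def fps_sum_nth mult.assoc[symmetric]
            fps_mult_fps_X_commute[symmetric] del: pow_mat.simps)
      then show ?thesis
        using that Suc by (simp add: R_def)
    qed
  qed
  have "(1\<^sub>m n - P) * R = R - P * R" "R * (1\<^sub>m n - P) = R - R * P"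
    using R P by (simp_all add: minus_mult_distrib_mat[OF one_carrier_mat P R]
        mult_minus_distrib_mat[OF R one_carrier_mat P])
  moreover have "R - P * R = 1\<^sub>m n" "R - R * P = 1\<^sub>m n"
    using R P by (auto intro!: eq_matI simp: PR RP simp del: index_mult_mat(1))
  ultimately have inv: "mat_inv (1\<^sub>m (dim_row A) - fps_X \<cdot>\<^sub>m map_mat fps_const A) = R"
    using A R P minus_carrier_mat[OF P, of "1\<^sub>m n"] by (intro mat_inv_eqI[of _ n]) (simp_all flip: P_def)
  have "fps_nth ((map_mat fps_const C * R * map_mat fps_const B) $$ (0, 0)) k = (C * A ^\<^sub>m k * B) $$ (0, 0)" for k
    using A B C Ak[of k] by (simp add: R_def scalar_prod_def fps_sum_nth)
  then show ?thesis
    by (intro fps_ext) (simp add: realization_fun_def realization_series_def inv)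
qed

text \<open>The states are the columns \<open>A ^\<^sub>m k * B\<close>. Describing them by a
  recursion replaces matrix powers by a one-step computation.\<close>

lemma state_sequence:
  assumes A: "A \<in> carrier_mat n n" and B: "B \<in> carrier_mat n 1" and C: "C \<in> carrier_mat 1 n"
  obtains h :: "nat \<Rightarrow> nat \<Rightarrow> quat" where
    "\<And>i. i < n \<Longrightarrow> h 0 i = B $$ (i, 0)"
    "\<And>k i. i < n \<Longrightarrow> h (Suc k) i = (\<Sum>j<n. A $$ (i, j) * h k j)"
    "\<And>k. fps_nth (realization_series A B C D) (Suc k) = (\<Sum>j<n. C $$ (0, j) * h k j)"
    "fps_nth (realization_series A B C D) 0 = D"
proof (rule that[of "\<lambda>k i. (A ^\<^sub>m k * B) $$ (i, 0)"])
  have Ak: "A ^\<^sub>m k \<in> carrier_mat n n" for k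
    using A by simp
  have Suc_left: "A ^\<^sub>m Suc k * B = A * (A ^\<^sub>m k * B)" for k
    unfolding pow_mat_Suc_left[OF A] by (rule assoc_mult_mat[OF A Ak B])
  show "(A ^\<^sub>m 0 * B) $$ (i, 0) = B $$ (i, 0)" if "i < n" for i
    using A B that by simp
  show "(A ^\<^sub>m Suc k * B) $$ (i, 0) = (\<Sum>j<n. A $$ (i, j) * (A ^\<^sub>m k * B) $$ (j, 0))" if "i < n" for k i
  proof -
    have "A ^\<^sub>m k * B \<in> carrier_mat n 1"
      by (rule mult_carrier_mat[OF Ak B])
    then show ?thesis
      unfolding Suc_left using A that
      by (subst index_mult_mat) (auto simp: scalar_prod_def lessThan_atLeast0)
  qed
  show "fps_nth (realization_series A B C D) (Suc k) = (\<Sum>j<n. C $$ (0, j) * (A ^\<^sub>m k * B) $$ (j, 0))" for k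
  proof -
    have "C * A ^\<^sub>m k * B = C * (A ^\<^sub>m k * B)"
      using A B C Ak[of k] by (simp add: assoc_mult_mat[of _ 1 n _ n _ 1])
    moreover have "A ^\<^sub>m k * B \<in> carrier_mat n 1"
      by (rule mult_carrier_mat[OF Ak B])
    ultimately show ?thesis
      unfolding realization_series_def using A C
      by (simp del: index_mult_mat, subst index_mult_mat) (auto simp: scalar_prod_def lessThan_atLeast0)
  qed
qed (simp add: realization_series_def)

text \<open>The recursion and its initial value determine the states, so it suffices to guess a
  solution \<open>h\<close>.\<close>

lemma realization_series_eqI:
  assumes A: "A \<in> carrier_mat n n" and B: "B \<in> carrier_mat n 1" and C: "C \<in> carrier_mat 1 n"
    and h0: "\<And>i. i < n \<Longrightarrow> h 0 i = B $$ (i, 0)"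
    and hS: "\<And>k i. i < n \<Longrightarrow> h (Suc k) i = (\<Sum>j<n. A $$ (i, j) * h k j)"
    and f0: "fps_nth f 0 = D" and fS: "\<And>k. fps_nth f (Suc k) = (\<Sum>j<n. C $$ (0, j) * h k j)"
  shows "f = realization_series A B C D"
proof -
  obtain g where g: "\<And>i. i < n \<Longrightarrow> g 0 i = B $$ (i, 0)"
    "\<And>k i. i < n \<Longrightarrow> g (Suc k) i = (\<Sum>j<n. A $$ (i, j) * g k j)"
    "\<And>k. fps_nth (realization_series A B C D) (Suc k) = (\<Sum>j<n. C $$ (0, j) * g k j)"
    "fps_nth (realization_series A B C D) 0 = D"
    by (rule state_sequence[OF A B C, of D]) (rule that; assumption)
  have "h k i = g k i" if "i < n" for k i
    using that by (induction k arbitrary: i) (simp_all add: h0 hS g)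
  then have "fps_nth f k = fps_nth (realization_series A B C D) k" for k
    by (cases k) (simp_all add: f0 fS g)
  then show ?thesis
    by (rule fps_ext)
qed

section \<open>Unitary changes of the state space\<close>

lemma mult_mat_vec_right_scale:
  fixes A :: "'a :: semiring_0 mat"
  assumes "A \<in> carrier_mat m n" "x \<in> carrier_vec n"
  shows "A *\<^sub>v map_vec (\<lambda>t. t * \<alpha>) x = map_vec (\<lambda>t. t * \<alpha>) (A *\<^sub>v x)"
  using assms by (intro eq_vecI) (auto simp: scalar_prod_def sum_distrib_right mult.assoc)

lemma stable_iff:
  assumes "A \<in> carrier_mat n n"
  shows "stable A \<longleftrightarrow> (\<forall>x \<alpha>. x \<in> carrier_vec n \<longrightarrow> x \<noteq> 0\<^sub>v n \<longrightarrow>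
    A *\<^sub>v x = map_vec (\<lambda>t. t * \<alpha>) x \<longrightarrow> norm \<alpha> < 1)"
  using assms unfolding stable_def right_eigenvalues_def by auto

text \<open>The colligation is conjugated by the block sum of \<open>V\<close> and 1,
  \<open>V\<close> carries eigenvectors of the new state matrix to eigenvectors of \<open>A\<close>
  with the same eigenvalue, and in \<open>C' * A' ^\<^sub>m k * B'\<close> the inner factors
  \<open>V * qadjoint V\<close> collapse.\<close>

lemma stable_unitary_similar:
  assumes su: "stable_unitary n A B C D" and V: "qunitary n V"
  defines "A' \<equiv> qadjoint V * A * V" and "B' \<equiv> qadjoint V * B" and "C' \<equiv> C * V"
  shows "stable_unitary n A' B' C' D"
    and "realization_series A' B' C' D = realization_series A B C D"
proof -
  have A: "A \<in> carrier_mat n n" and B: "B \<in> carrier_mat n 1" and C: "C \<in> carrier_mat 1 n"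
    and U: "qunitary (n + 1) (colligation A B C D)" and st: "stable A"
    using su by (simp_all add: stable_unitary_def)
  have Vc: "V \<in> carrier_mat n n" and VV: "V * qadjoint V = 1\<^sub>m n" "qadjoint V * V = 1\<^sub>m n"
    using V by (simp_all add: qunitary_def)
  have Va: "qadjoint V \<in> carrier_mat n n"
    using Vc by simp
  have carr: "A' \<in> carrier_mat n n" "B' \<in> carrier_mat n 1" "C' \<in> carrier_mat 1 n"
    unfolding A'_def B'_def C'_def
    by (rule mult_carrier_mat[OF mult_carrier_mat[OF Va A] Vc] mult_carrier_mat[OF Va B] mult_carrier_mat[OF C Vc])+
  define W where "W = four_block_mat V (0\<^sub>m n 1) (0\<^sub>m 1 n) (1\<^sub>m 1)"
  have Wa: "qadjoint W = four_block_mat (qadjoint V) (0\<^sub>m n 1) (0\<^sub>m 1 n) (1\<^sub>m 1)"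
    using Vc by (intro eq_matI) (auto simp: W_def)
  have "W * qadjoint W = four_block_mat (1\<^sub>m n) (0\<^sub>m n 1) (0\<^sub>m 1 n) (1\<^sub>m 1)"
    unfolding Wa unfolding W_def
    by (subst mult_four_block_mat[of _ n n _ 1 _ 1 _ _ n _ 1]) (use Vc Va VV in simp_all)
  moreover have "qadjoint W * W = four_block_mat (1\<^sub>m n) (0\<^sub>m n 1) (0\<^sub>m 1 n) (1\<^sub>m 1)"
    unfolding Wa unfolding W_def
    by (subst mult_four_block_mat[of _ n n _ 1 _ 1 _ _ n _ 1]) (use Vc Va VV in simp_all)
  moreover have "W \<in> carrier_mat (n + 1) (n + 1)"
    unfolding W_def using Vc by (intro four_block_carrier_mat) auto
  ultimately have W: "qunitary (n + 1) W"
    by (simp add: qunitary_def)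
  have "qadjoint W * (colligation A B C D * W) = colligation A' B' C' D"
  proof -
    have D: "mat 1 1 (\<lambda>_. D) \<in> carrier_mat 1 1"
      by simp
    have "colligation A B C D * W = four_block_mat (A * V) B (C * V) (mat 1 1 (\<lambda>_. D))"
      unfolding colligation_def W_def
      by (subst mult_four_block_mat[of _ n n _ 1 _ 1 _ _ n _ 1]) (use A B C D Vc in simp_all)
    then show ?thesis
      unfolding Wa colligation_def A'_def B'_def C'_def
      by (simp, subst mult_four_block_mat[of _ n n _ 1 _ 1 _ _ n _ 1])
        (use A B C D Vc Va mult_carrier_mat[OF Va mult_carrier_mat[OF A Vc]] mult_carrier_mat[OF Va B]
          in \<open>simp_all add: assoc_mult_mat[of _ n n _ n _ n]\<close>)
  qed
  then have "qunitary (n + 1) (colligation A' B' C' D)"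
    using qunitary_mult[OF qunitary_qadjoint[OF W] qunitary_mult[OF U W]] by simp
  moreover have "stable A'"
    unfolding stable_iff[OF carr(1)]
  proof (intro allI impI)
    fix x \<alpha> assume x: "x \<in> carrier_vec n" "x \<noteq> 0\<^sub>v n" and eig: "A' *\<^sub>v x = map_vec (\<lambda>t. t * \<alpha>) x"
    have Vx: "V *\<^sub>v x \<in> carrier_vec n"
      using Vc x by simp
    have ret: "qadjoint V *\<^sub>v (V *\<^sub>v x) = x"
      using assoc_mult_mat_vec[OF Va Vc x(1)] x by (simp add: VV)
    have "A *\<^sub>v (V *\<^sub>v x) = V *\<^sub>v (A' *\<^sub>v x)"
    proof -
      have "V * A' = (V * qadjoint V) * A * V"
        unfolding A'_def using A Vc Va
        by (simp add: assoc_mult_mat[of _ n n _ n _ n] mult_carrier_mat[of _ n n _ n])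
      then have "V * A' = A * V"
        using A Vc VV by simp
      then show ?thesis
        using assoc_mult_mat_vec[OF A Vc x(1)] assoc_mult_mat_vec[OF Vc carr(1) x(1)] by simp
    qed
    then have "A *\<^sub>v (V *\<^sub>v x) = map_vec (\<lambda>t. t * \<alpha>) (V *\<^sub>v x)"
      using eig mult_mat_vec_right_scale[OF Vc x(1)] by simp
    moreover have "V *\<^sub>v x \<noteq> 0\<^sub>v n"
    proof
      assume "V *\<^sub>v x = 0\<^sub>v n"
      then have "x = qadjoint V *\<^sub>v 0\<^sub>v n"
        using ret by simp
      also have "\<dots> = 0\<^sub>v n"
        using Vc by (intro eq_vecI) (simp_all add: scalar_prod_def)
      finally show False
        using x by simp
    qed
    ultimately show "norm \<alpha> < 1"
      using st Vx unfolding stable_iff[OF A] by blast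
  qed
  ultimately show "stable_unitary n A' B' C' D"
    using carr by (simp add: stable_unitary_def)
  have "C' * A' ^\<^sub>m k * B' = C * A ^\<^sub>m k * B" for k
  proof -
    have "similar_mat_wit A' A (qadjoint V) V"
      using carr A Vc Va VV by (intro similar_mat_witI[of _ _ n]) (simp_all flip: A'_def)
    then have *: "A' ^\<^sub>m k = qadjoint V * A ^\<^sub>m k * V"
      by (rule similar_mat_wit_pow_id)
    have Ak: "A ^\<^sub>m k \<in> carrier_mat n n"
      using A by simp
    have "C' * A' ^\<^sub>m k * B' = C * (V * qadjoint V) * A ^\<^sub>m k * (V * qadjoint V) * B"
      unfolding * C'_def B'_def using B C Vc Va Ak
      by (simp add: assoc_mult_mat[of _ 1 n _ n _ n] assoc_mult_mat[of _ 1 n _ n _ 1]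
        assoc_mult_mat[of _ n n _ n _ n] assoc_mult_mat[of _ n n _ n _ 1]
        mult_carrier_mat[of _ n n _ n] mult_carrier_mat[of _ n n _ "Suc 0"])
    then show ?thesis
      by (simp only: VV right_mult_one_mat[OF C] right_mult_one_mat[OF mult_carrier_mat[OF C Ak]])
  qed
  then show "realization_series A' B' C' D = realization_series A B C D"
    by (simp only: realization_series_def)
qed

section \<open>The entries of a unitary colligation\<close>

text \<open>For a colligation \<open>U\<close>, the three functions \<open>row_gram\<close>,
  \<open>row_mix\<close> and \<open>row_out\<close> are the state-state, state-output and
  output-output entries of \<open>U * qadjoint U\<close>. The remaining block is conjugate to
  \<open>row_mix\<close>.\<close>

definition row_gram :: "quat mat \<Rightarrow> quat mat \<Rightarrow> nat \<Rightarrow> nat \<Rightarrow> quat" where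
  "row_gram A B i j = (\<Sum>k<dim_col A. A $$ (i, k) * qcnj (A $$ (j, k))) + B $$ (i, 0) * qcnj (B $$ (j, 0))"

definition row_mix :: "quat mat \<Rightarrow> quat mat \<Rightarrow> quat mat \<Rightarrow> quat \<Rightarrow> nat \<Rightarrow> quat" where
  "row_mix A B C D i = (\<Sum>k<dim_col A. A $$ (i, k) * qcnj (C $$ (0, k))) + B $$ (i, 0) * qcnj D"

definition row_out :: "quat mat \<Rightarrow> quat \<Rightarrow> quat" where
  "row_out C D = (\<Sum>k<dim_col C. C $$ (0, k) * qcnj (C $$ (0, k))) + D * qcnj D"

lemma colligation_carrier:
  "A \<in> carrier_mat n n \<Longrightarrow> colligation A B C D \<in> carrier_mat (n + 1) (n + 1)"
  unfolding colligation_def by (intro four_block_carrier_mat) auto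

lemma colligation_coisometry_iff:
  assumes A: "A \<in> carrier_mat n n" and B: "B \<in> carrier_mat n 1" and C: "C \<in> carrier_mat 1 n"
  shows "colligation A B C D * qadjoint (colligation A B C D) = 1\<^sub>m (n + 1) \<longleftrightarrow>
    (\<forall>i<n. \<forall>j<n. row_gram A B i j = (if i = j then 1 else 0)) \<and>
    (\<forall>i<n. row_mix A B C D i = 0) \<and> row_out C D = 1"
proof -
  let ?U = "colligation A B C D"
  have U: "?U $$ (i, k) = A $$ (i, k)" if "i < n" "k < n" for i k
    using that A B C by (simp add: colligation_def)
  have Unn: "?U $$ (n, n) = D"
    using A B C by (simp add: colligation_def)
  have Uin: "?U $$ (i, n) = B $$ (i, 0)" if "i < n" for i
    using that A B C by (simp add: colligation_def)
  have Unk: "?U $$ (n, k) = C $$ (0, k)" if "k < n" for k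
    using that A B C by (simp add: colligation_def)
  have mix: "(\<Sum>k<n. C $$ (0, k) * qcnj (A $$ (i, k))) + D * qcnj (B $$ (i, 0)) = qcnj (row_mix A B C D i)" for i
    using A by (simp add: row_mix_def qcnj_sum)
  have qcnj_eq_0: "qcnj q = 0 \<longleftrightarrow> q = 0" for q
    by (simp add: quat_eq_iff)
  have ii: "(\<Sum>k<Suc n. ?U $$ (i, k) * qcnj (?U $$ (j, k))) = row_gram A B i j" if "i < n" "j < n" for i j
    using that A by (simp add: U Uin row_gram_def)
  have io: "(\<Sum>k<Suc n. ?U $$ (i, k) * qcnj (?U $$ (n, k))) = row_mix A B C D i" if "i < n" for i
    using that A by (simp add: U Uin Unn Unk row_mix_def)
  have oi: "(\<Sum>k<Suc n. ?U $$ (n, k) * qcnj (?U $$ (i, k))) = qcnj (row_mix A B C D i)" if "i < n" for i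
    using that A by (simp add: U Uin Unn Unk flip: mix)
  have oo: "(\<Sum>k<Suc n. ?U $$ (n, k) * qcnj (?U $$ (n, k))) = row_out C D"
    using C by (simp add: Unn Unk row_out_def)
  show ?thesis
    unfolding mult_qadjoint_eq_1_iff[OF colligation_carrier[OF A]]
    by (auto simp del: sum.lessThan_Suc simp add: All_less_Suc ii io oi oo qcnj_eq_0)
qed

lemma qadjoint_colligation:
  assumes "A \<in> carrier_mat n n" "B \<in> carrier_mat n 1" "C \<in> carrier_mat 1 n"
  shows "qadjoint (colligation A B C D) = colligation (qadjoint A) (qadjoint C) (qadjoint B) (qcnj D)"
  using assms unfolding colligation_def by (intro eq_matI) auto

text \<open>The adjoint of a colligation is again a colligation, with \<open>B\<close> and
  \<open>C\<close> exchanged, so the column relations are the row relations of the adjoint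
  data.\<close>

lemma qunitary_colligation_iff:
  assumes A: "A \<in> carrier_mat n n" and B: "B \<in> carrier_mat n 1" and C: "C \<in> carrier_mat 1 n"
  shows "qunitary (n + 1) (colligation A B C D) \<longleftrightarrow>
    (\<forall>i<n. \<forall>j<n. row_gram A B i j = (if i = j then 1 else 0)) \<and>
    (\<forall>i<n. row_mix A B C D i = 0) \<and> row_out C D = 1 \<and>
    (\<forall>i<n. \<forall>j<n. row_gram (qadjoint A) (qadjoint C) i j = (if i = j then 1 else 0)) \<and>
    (\<forall>i<n. row_mix (qadjoint A) (qadjoint C) (qadjoint B) (qcnj D) i = 0) \<and>
    row_out (qadjoint B) (qcnj D) = 1"
proof -
  have *: "qadjoint A \<in> carrier_mat n n" "qadjoint C \<in> carrier_mat n 1" "qadjoint B \<in> carrier_mat 1 n"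
    using A B C by simp_all
  have "qadjoint (colligation (qadjoint A) (qadjoint C) (qadjoint B) (qcnj D)) = colligation A B C D"
    using qadjoint_colligation[OF *, of "qcnj D"] by simp
  then show ?thesis
    unfolding qunitary_def
    using colligation_carrier[OF A, of B C D] colligation_coisometry_iff[OF A B C, of D]
      colligation_coisometry_iff[OF *, of "qcnj D"] qadjoint_colligation[OF A B C, of D]
    by auto
qed

section \<open>Cascading with a Blaschke factor\<close>

text \<open>With \<open>s = defect w\<close>, the colligation \<open>[cnj w, s; s, - w]\<close> is unitary and realizes the Blaschke
  factor of \<open>w\<close>. The cascade places its state in front of the state of the second system.\<close>

definition defect :: "quat \<Rightarrow> real" where
  "defect w = sqrt (1 - (norm w)\<^sup>2)"

text \<open>Block upper triangular: the second system drives the state of the Blaschke factor and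
  receives nothing back.\<close>

definition cascade_A :: "quat \<Rightarrow> quat mat \<Rightarrow> quat mat \<Rightarrow> quat mat" where
  "cascade_A w A C = mat (dim_row A + 1) (dim_row A + 1) (\<lambda>(i, j).
     case i of 0 \<Rightarrow> (case j of 0 \<Rightarrow> qcnj w | Suc j \<Rightarrow> defect w *\<^sub>R C $$ (0, j))
     | Suc i \<Rightarrow> (case j of 0 \<Rightarrow> 0 | Suc j \<Rightarrow> A $$ (i, j)))"

definition cascade_B :: "quat \<Rightarrow> quat mat \<Rightarrow> quat \<Rightarrow> quat mat" where
  "cascade_B w B D = mat (dim_row B + 1) 1 (\<lambda>(i, _).
     case i of 0 \<Rightarrow> defect w *\<^sub>R D | Suc i \<Rightarrow> B $$ (i, 0))"

definition cascade_C :: "quat \<Rightarrow> quat mat \<Rightarrow> quat mat" where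
  "cascade_C w C = mat 1 (dim_col C + 1) (\<lambda>(_, j).
     case j of 0 \<Rightarrow> of_real (defect w) | Suc j \<Rightarrow> - (w * C $$ (0, j)))"

lemma defect_power2: "norm w < 1 \<Longrightarrow> defect w * defect w = 1 - (norm w)\<^sup>2"
  by (simp add: defect_def abs_square_le_1 power2_eq_square[symmetric])

lemma defect_pos: "norm w < 1 \<Longrightarrow> defect w > 0"
  by (simp add: defect_def abs_square_less_1)

locale cascade =
  fixes n :: nat and A B C :: "quat mat" and D w :: quat
  assumes A: "A \<in> carrier_mat n n" and B: "B \<in> carrier_mat n 1" and C: "C \<in> carrier_mat 1 n"
    and w: "norm w < 1"
begin

abbreviation "s \<equiv> defect w"
abbreviation "A' \<equiv> cascade_A w A C"
abbreviation "B' \<equiv> cascade_B w B D"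
abbreviation "C' \<equiv> cascade_C w C"
abbreviation "D' \<equiv> - (w * D)"

lemma carriers: "A' \<in> carrier_mat (Suc n) (Suc n)" "B' \<in> carrier_mat (Suc n) 1" "C' \<in> carrier_mat 1 (Suc n)"
  using A B C by (simp_all add: cascade_A_def cascade_B_def cascade_C_def)

lemma entries:
  "A' $$ (0, 0) = qcnj w"
  "j < n \<Longrightarrow> A' $$ (0, Suc j) = s *\<^sub>R C $$ (0, j)"
  "i < n \<Longrightarrow> A' $$ (Suc i, 0) = 0"
  "i < n \<Longrightarrow> j < n \<Longrightarrow> A' $$ (Suc i, Suc j) = A $$ (i, j)"
  "B' $$ (0, 0) = s *\<^sub>R D"
  "i < n \<Longrightarrow> B' $$ (Suc i, 0) = B $$ (i, 0)"
  "C' $$ (0, 0) = of_real s"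
  "j < n \<Longrightarrow> C' $$ (0, Suc j) = - (w * C $$ (0, j))"
  using A B C by (simp_all add: cascade_A_def cascade_B_def cascade_C_def)

text \<open>\<open>row_out C D\<close> is left unevaluated, since unitarity of the second system is
  to be derived from that of the cascade as well.\<close>

lemma rows:
  "row_gram A' B' 0 0 = of_real ((norm w)\<^sup>2) + (s * s) *\<^sub>R row_out C D"
  "j < n \<Longrightarrow> row_gram A' B' 0 (Suc j) = s *\<^sub>R qcnj (row_mix A B C D j)"
  "i < n \<Longrightarrow> row_gram A' B' (Suc i) 0 = s *\<^sub>R row_mix A B C D i"
  "i < n \<Longrightarrow> j < n \<Longrightarrow> row_gram A' B' (Suc i) (Suc j) = row_gram A B i j"
  "row_mix A' B' C' D' 0 = s *\<^sub>R qcnj w - s *\<^sub>R (row_out C D * qcnj w)"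
  "i < n \<Longrightarrow> row_mix A' B' C' D' (Suc i) = - row_mix A B C D i * qcnj w"
  "row_out C' D' = of_real (s * s) + w * row_out C D * qcnj w"
  using A B C carriers
  by (simp_all add: row_gram_def row_mix_def row_out_def entries sum.lessThan_Suc_shift qcnj_mult_quat
      qcnj_sum sum_distrib_left sum_distrib_right scaleR_right.sum sum_negf algebra_simps of_real_def
      del: sum.lessThan_Suc)

text \<open>The term \<open>- (qcnj D * qcnj w)\<close> is the simplified form of
  \<open>qcnj D'\<close>.\<close>

lemma columns:
  "row_gram (qadjoint A') (qadjoint C') 0 0 = 1"
  "j < n \<Longrightarrow> row_gram (qadjoint A') (qadjoint C') 0 (Suc j) = 0"
  "i < n \<Longrightarrow> row_gram (qadjoint A') (qadjoint C') (Suc i) 0 = 0"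
  "i < n \<Longrightarrow> j < n \<Longrightarrow> row_gram (qadjoint A') (qadjoint C') (Suc i) (Suc j) =
    row_gram (qadjoint A) (qadjoint C) i j"
  "row_mix (qadjoint A') (qadjoint C') (qadjoint B') (- (qcnj D * qcnj w)) 0 = 0"
  "i < n \<Longrightarrow> row_mix (qadjoint A') (qadjoint C') (qadjoint B') (- (qcnj D * qcnj w)) (Suc i) =
    row_mix (qadjoint A) (qadjoint C) (qadjoint B) (qcnj D) i"
  "row_out (qadjoint B') (- (qcnj D * qcnj w)) = row_out (qadjoint B) (qcnj D)"
proof -
  \<comment> \<open>\<open>C\<close> and \<open>D\<close> enter the cascade twice, with weights
    \<open>s\<close> and \<open>w\<close>; the squared moduli of these weights add up to 1.\<close>
  have split: "(s * s) *\<^sub>R (p * q) + p * (qcnj w * w) * q = p * q" for p q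
    by (simp add: defect_power2[OF w] qcnj_mult_quat of_real_def algebra_simps)
  have ww: "w * qcnj w + of_real (s * s) = 1"
    by (simp add: quat_mult_qcnj defect_power2[OF w] del: of_real_mult of_real_power flip: of_real_add)
  note simps = row_gram_def row_mix_def row_out_def entries sum.lessThan_Suc_shift
  show "row_gram (qadjoint A') (qadjoint C') 0 0 = 1"
    using A B C carriers ww by (simp add: simps del: sum.lessThan_Suc)
  show "row_gram (qadjoint A') (qadjoint C') 0 (Suc j) = 0" if "j < n" for j
    using that A B C carriers by (simp add: simps of_real_def del: sum.lessThan_Suc)
  show "row_gram (qadjoint A') (qadjoint C') (Suc i) 0 = 0" if "i < n" for i
    using that A B C carriers by (simp add: simps of_real_def del: sum.lessThan_Suc)
  show "row_gram (qadjoint A') (qadjoint C') (Suc i) (Suc j) =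
      row_gram (qadjoint A) (qadjoint C) i j" if "i < n" "j < n" for i j
    using that A B C carriers split[of "qcnj (C $$ (0, i))" "C $$ (0, j)"]
    by (simp add: simps mult.assoc algebra_simps del: sum.lessThan_Suc)
  show "row_mix (qadjoint A') (qadjoint C') (qadjoint B') (- (qcnj D * qcnj w)) 0 = 0"
    using A B C carriers by (simp add: simps of_real_def del: sum.lessThan_Suc)
  show "row_mix (qadjoint A') (qadjoint C') (qadjoint B') (- (qcnj D * qcnj w)) (Suc i) =
    row_mix (qadjoint A) (qadjoint C) (qadjoint B) (qcnj D) i" if "i < n" for i
    using that A B C carriers split[of "qcnj (C $$ (0, i))" D]
    by (simp add: simps mult.assoc algebra_simps del: sum.lessThan_Suc)
  show "row_out (qadjoint B') (- (qcnj D * qcnj w)) = row_out (qadjoint B) (qcnj D)"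
    using A B C carriers split[of "qcnj D" D]
    by (simp add: simps mult.assoc algebra_simps del: sum.lessThan_Suc)
qed

lemma unitary_iff:
  "qunitary (Suc n + 1) (colligation A' B' C' D') \<longleftrightarrow> qunitary (n + 1) (colligation A B C D)"
proof -
  have s: "s > 0"
    by (rule defect_pos[OF w])
  have qcnj_eq_0: "qcnj q = 0 \<longleftrightarrow> q = 0" for q
    by (simp add: quat_eq_iff)
  \<comment> \<open>The corner entry of the row relations is a convex combination of 1 and
    \<open>row_out C D\<close> with nonzero weight on the latter.\<close>
  have out: "of_real ((norm w)\<^sup>2) + (s * s) *\<^sub>R q = 1 \<longleftrightarrow> q = 1" for q :: quat
  proof -
    have "of_real ((norm w)\<^sup>2) + (s * s) *\<^sub>R q - 1 = (s * s) *\<^sub>R (q - 1)"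
      by (simp add: defect_power2[OF w] of_real_def algebra_simps)
    then show ?thesis
      using s by (metis eq_iff_diff_eq_0 less_irrefl mult_eq_0_iff scaleR_eq_0_iff)
  qed
  have last: "of_real s * of_real s + w * qcnj w = 1"
    unfolding of_real_mult[symmetric]
    by (simp add: quat_mult_qcnj defect_power2[OF w] del: of_real_mult of_real_power flip: of_real_add)
  show ?thesis
  \<comment> \<open>If the output row of the second system is not normalized, neither colligation is
    unitary; otherwise the extra terms in \<open>w\<close> cancel.\<close>
  proof (cases "row_out C D = 1")
    case True
    show ?thesis
      unfolding qunitary_colligation_iff[OF A B C] qunitary_colligation_iff[OF carriers] All_less_Suc2
      using s last out[of 1] by (simp add: True rows columns qcnj_eq_0) blast
  next
    case False
    then have "row_gram A' B' 0 0 \<noteq> 1"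
      by (simp only: rows out not_False_eq_True)
    then have "\<not> (\<forall>i<Suc n. \<forall>j<Suc n. row_gram A' B' i j = (if i = j then 1 else 0))"
      by auto
    with False show ?thesis
      unfolding qunitary_colligation_iff[OF A B C] qunitary_colligation_iff[OF carriers] by blast
  qed
qed

text \<open>The first state component is driven by the output of the second system, so it
  accumulates the coefficients of that output multiplied by the geometric series \<open>K\<close> of
  the Blaschke factor.\<close>

lemma series:
  "realization_series A' B' C' D' = blaschke_factor w * realization_series A B C D"
proof -
  define f where "f = realization_series A B C D"
  define K where "K = Abs_fps (\<lambda>k. qcnj w ^ k)"
  \<comment> \<open>This fixed-point equation supplies the recursion for the coefficients of
    \<open>K * f\<close>.\<close>
  have K: "K = 1 + fps_X * (fps_const (qcnj w) * K)"
    by (rule fps_ext) (simp add: K_def power_eq_if)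
  have Kf: "K * f = f + fps_X * (fps_const (qcnj w) * (K * f))"
    by (subst K) (simp add: algebra_simps)
  have K0: "fps_nth K 0 = 1"
    by (simp add: K_def)
  have Kf0: "fps_nth (K * f) 0 = fps_nth f 0"
    by (simp add: K0)
  have KfS: "fps_nth (K * f) (Suc k) = fps_nth f (Suc k) + qcnj w * fps_nth (K * f) k" for k
    by (subst Kf) simp
  obtain h where h: "\<And>i. i < n \<Longrightarrow> h 0 i = B $$ (i, 0)"
    "\<And>k i. i < n \<Longrightarrow> h (Suc k) i = (\<Sum>j<n. A $$ (i, j) * h k j)"
    "\<And>k. fps_nth (realization_series A B C D) (Suc k) = (\<Sum>j<n. C $$ (0, j) * h k j)"
    "fps_nth (realization_series A B C D) 0 = D"
    by (rule state_sequence[OF A B C, of D]) (rule that; assumption)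
  note h = h[folded f_def]
  define g where "g = (\<lambda>k i. case i of 0 \<Rightarrow> s *\<^sub>R fps_nth (K * f) k | Suc i \<Rightarrow> h k i)"
  have bf: "blaschke_factor w * f = fps_X * (K * f) - fps_const w * (K * f)"
    by (simp add: blaschke_factor_def K_def[symmetric] algebra_simps)
  have "blaschke_factor w * f = realization_series A' B' C' D'"
  proof (rule realization_series_eqI[OF carriers, of g])
    show "g 0 i = B' $$ (i, 0)" if "i < Suc n" for i
      using that by (cases i) (simp_all add: g_def entries h K0)
    show "g (Suc k) i = (\<Sum>j<Suc n. A' $$ (i, j) * g k j)" if "i < Suc n" for k i
      using that by (cases i) (simp_all add: g_def entries h KfS sum.lessThan_Suc_shift
          scaleR_right.sum algebra_simps del: sum.lessThan_Suc)
    show "fps_nth (blaschke_factor w * f) 0 = D'"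
      unfolding bf by (simp add: K0 h)
    fix k
    \<comment> \<open>Reduces coefficient \<open>Suc k\<close> of
      \<open>fps_X * (K * f) - fps_const w * (K * f)\<close> to a multiple of the first state
      component plus the direct term.\<close>
    have "w * (qcnj w * q) = q - (s * s) *\<^sub>R q" for q
      by (simp add: defect_power2[OF w] quat_mult_qcnj of_real_def algebra_simps flip: mult.assoc)
    then show "fps_nth (blaschke_factor w * f) (Suc k) = (\<Sum>j<Suc n. C' $$ (0, j) * g k j)"
      unfolding bf by (simp add: g_def entries h KfS sum.lessThan_Suc_shift of_real_def
          sum_negf sum_distrib_left algebra_simps del: sum.lessThan_Suc)
  qed
  then show ?thesis
    by (simp add: f_def)
qed

end

section \<open>Stability of a cascade\<close>

text \<open>The solution comes from the minimal polynomial of \<open>\<alpha>\<close> evaluated at \<open>\<beta>\<close>, which is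
  nonzero because \<open>\<alpha>\<close> and \<open>\<beta>\<close> are not similar.\<close>

lemma quat_sylvester:
  fixes \<alpha> \<beta> c :: quat
  assumes "norm \<alpha> \<noteq> norm \<beta>"
  obtains t where "\<alpha> * t - t * \<beta> = c"
proof -
  define q where "q = \<beta> * \<beta> - (2 * Req \<alpha>) *\<^sub>R \<beta> + of_real ((norm \<alpha>)\<^sup>2)"
  have q: "q \<noteq> 0"
  proof
    assume "q = 0"
    \<comment> \<open>The imaginary parts of \<open>q\<close> are \<open>2 * p\<close> times those
      of \<beta>. If \<open>p = 0\<close>, the real part gives equal norms; otherwise \<beta> is
      real and the real part of \<open>q\<close> is a sum of squares containing \<open>p\<close>
      squared, which is absurd.\<close>
    define p where "p = Req \<beta> - Req \<alpha>"
    have "Req q = 0" "Imi q = 0" "Imj q = 0" "Imk q = 0"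
      using \<open>q = 0\<close> by simp_all
    then have eqs: "(Req \<beta>)\<^sup>2 - (Imi \<beta>)\<^sup>2 - (Imj \<beta>)\<^sup>2 - (Imk \<beta>)\<^sup>2 - 2 * Req \<alpha> * Req \<beta> + (norm \<alpha>)\<^sup>2 = 0"
      "p * Imi \<beta> = 0" "p * Imj \<beta> = 0" "p * Imk \<beta> = 0"
      by (simp_all add: q_def p_def of_real_def power2_eq_square algebra_simps)
    have "(norm \<alpha>)\<^sup>2 = (norm \<beta>)\<^sup>2"
    proof (cases "p = 0")
      case True
      then show ?thesis
        using eqs(1) unfolding norm_quat_power2[of \<beta>] p_def by (simp add: power2_eq_square)
    next
      case False
      then have im: "Imi \<beta> = 0" "Imj \<beta> = 0" "Imk \<beta> = 0"
        using eqs by simp_all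
      then have "p\<^sup>2 + ((Imi \<alpha>)\<^sup>2 + (Imj \<alpha>)\<^sup>2 + (Imk \<alpha>)\<^sup>2) = 0"
        using eqs(1) unfolding norm_quat_power2 p_def by (simp add: power2_eq_square algebra_simps)
      then have "p\<^sup>2 \<le> 0"
        using zero_le_power2[of "Imi \<alpha>"] zero_le_power2[of "Imj \<alpha>"] zero_le_power2[of "Imk \<alpha>"] by linarith
      then show ?thesis
        using False by simp
    qed
    then have "norm \<alpha> = norm \<beta>"
      using norm_ge_zero power2_eq_iff_nonneg by blast
    with assms show False
      by simp
  qed
  \<comment> \<open>\<open>q\<close> is a polynomial in \<beta> with real coefficients, so it and
    its inverse commute with \<beta>.\<close>
  have comm: "inverse q * \<beta> = \<beta> * inverse q"
  proof -
    have "inverse q * \<beta> = inverse q * (\<beta> * q) * inverse q"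
      using q by (simp add: mult.assoc)
    also have "\<beta> * q = q * \<beta>"
      by (simp add: q_def of_real_def algebra_simps)
    also have "inverse q * (q * \<beta>) * inverse q = \<beta> * inverse q"
      using q by (simp flip: mult.assoc)
    finally show ?thesis .
  qed
  \<comment> \<open>Applying first \<open>c \<mapsto> qcnj \<alpha> * c - c * \<beta>\<close> and
    then the same map with \<alpha> in place of \<open>qcnj \<alpha>\<close> yields
    \<open>c * q\<close>.\<close>
  define t where "t = (qcnj \<alpha> * c - c * \<beta>) * inverse q"
  have "\<alpha> * t - t * \<beta> = (\<alpha> * (qcnj \<alpha> * c - c * \<beta>) - (qcnj \<alpha> * c - c * \<beta>) * \<beta>) * inverse q"
    by (simp add: t_def mult.assoc comm left_diff_distrib)
  also have "\<alpha> * (qcnj \<alpha> * c - c * \<beta>) - (qcnj \<alpha> * c - c * \<beta>) * \<beta>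
      = (\<alpha> * qcnj \<alpha>) * c - (\<alpha> + qcnj \<alpha>) * (c * \<beta>) + c * \<beta> * \<beta>"
    by (simp add: algebra_simps)
  also have "\<alpha> + qcnj \<alpha> = of_real (2 * Req \<alpha>)"
    by (simp add: quat_eq_iff of_real_def)
  also have "\<alpha> * qcnj \<alpha> * c - of_real (2 * Req \<alpha>) * (c * \<beta>) + c * \<beta> * \<beta> = c * q"
    by (simp add: q_def quat_mult_qcnj of_real_def algebra_simps)
  finally have "\<alpha> * t - t * \<beta> = c"
    using q by (simp add: mult.assoc)
  then show thesis
    by (rule that)
qed

context cascade
begin

lemma mult_vec_entries:
  assumes x: "x \<in> carrier_vec (Suc n)"
  shows "(A' *\<^sub>v x) $ 0 = qcnj w * x $ 0 + s *\<^sub>R (\<Sum>j<n. C $$ (0, j) * x $ Suc j)"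
    and "i < n \<Longrightarrow> (A' *\<^sub>v x) $ Suc i = (A *\<^sub>v vec n (\<lambda>j. x $ Suc j)) $ i"
proof -
  have *: "(A' *\<^sub>v x) $ i = (\<Sum>j<Suc n. A' $$ (i, j) * x $ j)" if "i < Suc n" for i
    using that x carriers by (simp add: scalar_prod_def lessThan_atLeast0 del: sum.op_ivl_Suc)
  show "(A' *\<^sub>v x) $ 0 = qcnj w * x $ 0 + s *\<^sub>R (\<Sum>j<n. C $$ (0, j) * x $ Suc j)"
    by (subst *) (simp_all add: sum.lessThan_Suc_shift entries scaleR_right.sum del: sum.lessThan_Suc)
  show "(A' *\<^sub>v x) $ Suc i = (A *\<^sub>v vec n (\<lambda>j. x $ Suc j)) $ i" if "i < n"
    using that A by (subst *) (simp_all add: sum.lessThan_Suc_shift entries scalar_prod_def atLeast0LessThan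
        del: sum.lessThan_Suc)
qed

text \<open>By triangularity, the tail of an eigenvector of \<open>A'\<close> is zero or an
  eigenvector of \<open>A\<close>. Conversely, an eigenvector of \<open>A\<close> whose eigenvalue
  lies outside the ball extends to one of \<open>A'\<close> by solving a Sylvester equation for the
  new first entry.\<close>

lemma stable_iff_stable: "stable A' \<longleftrightarrow> stable A"
proof
  assume st: "stable A"
  show "stable A'"
    unfolding stable_iff[OF carriers(1)]
  proof (intro allI impI)
    fix x \<alpha> assume x: "x \<in> carrier_vec (Suc n)" "x \<noteq> 0\<^sub>v (Suc n)" and eig: "A' *\<^sub>v x = map_vec (\<lambda>t. t * \<alpha>) x"
    define y where "y = vec n (\<lambda>j. x $ Suc j)"
    have "A *\<^sub>v y = map_vec (\<lambda>t. t * \<alpha>) y"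
    proof (rule eq_vecI)
      fix i assume "i < dim_vec (map_vec (\<lambda>t. t * \<alpha>) y)"
      then have i: "i < n"
        by (simp add: y_def)
      then show "(A *\<^sub>v y) $ i = map_vec (\<lambda>t. t * \<alpha>) y $ i"
        using mult_vec_entries(2)[OF x(1) i] x(1) by (simp add: y_def eig)
    qed (use A in \<open>simp add: y_def\<close>)
    show "norm \<alpha> < 1"
    proof (cases "y = 0\<^sub>v n")
      case False
      then show ?thesis
        using st \<open>A *\<^sub>v y = _\<close> vec_carrier[of n "\<lambda>j. x $ Suc j", folded y_def]
        unfolding stable_iff[OF A] by blast
    next
      case True
      then have y0: "x $ Suc j = 0" if "j < n" for j
      proof -
        have "y $ j = 0"
          using True that by simp
        then show ?thesis
          using that by (simp add: y_def)
      qed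
      have x0: "x $ 0 \<noteq> 0"
      proof
        assume "x $ 0 = 0"
        then have "x $ i = 0" if "i < Suc n" for i
          using that y0 by (cases i) auto
        then have "x = 0\<^sub>v (Suc n)"
          using x(1) by (intro eq_vecI) auto
        with x show False
          by simp
      qed
      \<comment> \<open>With a vanishing tail only the corner entry acts, so \<alpha> has the
        modulus of \<open>w\<close>.\<close>
      have "qcnj w * x $ 0 = x $ 0 * \<alpha>"
        using mult_vec_entries(1)[OF x(1)] x(1) by (simp add: eig y0)
      then have "norm w * norm (x $ 0) = norm (x $ 0) * norm \<alpha>"
        by (metis norm_mult norm_qcnj)
      then show ?thesis
        using x0 w by simp
    qed
  qed
next
  assume st: "stable A'"
  show "stable A"
    unfolding stable_iff[OF A]
  proof (intro allI impI, rule ccontr)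
    fix y \<alpha> assume y: "y \<in> carrier_vec n" "y \<noteq> 0\<^sub>v n" and eig: "A *\<^sub>v y = map_vec (\<lambda>t. t * \<alpha>) y"
      and "\<not> norm \<alpha> < 1"
    then have "norm (qcnj w) \<noteq> norm \<alpha>"
      using w by auto
    then obtain t where t: "qcnj w * t - t * \<alpha> = - (s *\<^sub>R (\<Sum>j<n. C $$ (0, j) * y $ j))"
      by (rule quat_sylvester)
    define x where "x = vec (Suc n) (\<lambda>i. case i of 0 \<Rightarrow> t | Suc j \<Rightarrow> y $ j)"
    have x: "x \<in> carrier_vec (Suc n)"
      by (simp add: x_def)
    have xy: "vec n (\<lambda>j. x $ Suc j) = y"
      using y(1) by (intro eq_vecI) (auto simp: x_def)
    have "A' *\<^sub>v x = map_vec (\<lambda>t. t * \<alpha>) x"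
    proof (rule eq_vecI)
      fix i assume "i < dim_vec (map_vec (\<lambda>t. t * \<alpha>) x)"
      then have i: "i < Suc n"
        by (simp add: x_def)
      show "(A' *\<^sub>v x) $ i = map_vec (\<lambda>t. t * \<alpha>) x $ i"
      proof (cases i)
        case 0
        then show ?thesis
          using t by (simp add: mult_vec_entries(1)[OF x]) (simp add: x_def algebra_simps)
      next
        case (Suc j)
        then show ?thesis
          using i y(1) by (simp add: mult_vec_entries(2)[OF x] xy eig) (simp add: x_def)
      qed
    qed (use carriers in \<open>simp add: x_def\<close>)
    moreover have "x \<noteq> 0\<^sub>v (Suc n)"
      using xy y by auto
    ultimately show False
      using st x \<open>\<not> norm \<alpha> < 1\<close> unfolding stable_iff[OF carriers(1)] by blast
  qed
qed

lemma stable_unitary_iff: "stable_unitary (Suc n) A' B' C' D' \<longleftrightarrow> stable_unitary n A B C D"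
  using carriers A B C unitary_iff stable_iff_stable by (simp add: stable_unitary_def)

end

section \<open>Splitting off a Blaschke factor\<close>

text \<open>Only the first column is assumed to have cascade form. Its orthogonality to the other
  columns determines the output row from the first state row.\<close>

lemma stable_unitary_cascadeE:
  assumes su: "stable_unitary (Suc n) A B C D" and w: "norm w < 1"
    and A00: "A $$ (0, 0) = qcnj w" and Ai0: "\<And>i. i < n \<Longrightarrow> A $$ (Suc i, 0) = 0"
    and C0: "C $$ (0, 0) = of_real (defect w)"
  obtains A\<^sub>1 B\<^sub>1 C\<^sub>1 D\<^sub>1 where "stable_unitary n A\<^sub>1 B\<^sub>1 C\<^sub>1 D\<^sub>1"
    "realization_series A B C D = blaschke_factor w * realization_series A\<^sub>1 B\<^sub>1 C\<^sub>1 D\<^sub>1"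
proof -
  let ?s = "defect w"
  have s: "?s > 0"
    by (rule defect_pos[OF w])
  have A: "A \<in> carrier_mat (Suc n) (Suc n)" and B: "B \<in> carrier_mat (Suc n) 1" and C: "C \<in> carrier_mat 1 (Suc n)"
    and U: "qunitary (Suc n + 1) (colligation A B C D)"
    using su by (simp_all add: stable_unitary_def)
  have gram: "row_gram (qadjoint A) (qadjoint C) 0 j = 0" if "j < Suc n" "j \<noteq> 0" for j
    using U that unfolding qunitary_colligation_iff[OF A B C] by auto
  have mix: "row_mix (qadjoint A) (qadjoint C) (qadjoint B) (qcnj D) 0 = 0"
    using U unfolding qunitary_colligation_iff[OF A B C] by auto
  define A\<^sub>1 where "A\<^sub>1 = mat n n (\<lambda>(i, j). A $$ (Suc i, Suc j))"
  define B\<^sub>1 where "B\<^sub>1 = mat n 1 (\<lambda>(i, _). B $$ (Suc i, 0))"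
  \<comment> \<open>The first state row of a cascade carries \<open>C\<^sub>1\<close> and
    \<open>D\<^sub>1\<close> multiplied by the defect, which is nonzero.\<close>
  define C\<^sub>1 where "C\<^sub>1 = mat 1 n (\<lambda>(_, j). A $$ (0, Suc j) /\<^sub>R ?s)"
  define D\<^sub>1 where "D\<^sub>1 = B $$ (0, 0) /\<^sub>R ?s"
  interpret casc: cascade n A\<^sub>1 B\<^sub>1 C\<^sub>1 D\<^sub>1 w
    by standard (simp_all add: A\<^sub>1_def B\<^sub>1_def C\<^sub>1_def w)
  have solve: "q = - (w * (p /\<^sub>R ?s))" if "w * p + ?s *\<^sub>R q = 0" for p q
  proof -
    have "?s *\<^sub>R q = - (w * p)"
      using that by (simp add: add_eq_0_iff)
    then have "inverse ?s *\<^sub>R (?s *\<^sub>R q) = inverse ?s *\<^sub>R - (w * p)"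
      by (simp only:)
    then show ?thesis
      using s by simp
  qed
  have "w * A $$ (0, Suc j) + ?s *\<^sub>R C $$ (0, Suc j) = 0" if "j < n" for j
    using gram[of "Suc j"] that A C
    by (simp add: row_gram_def sum.lessThan_Suc_shift A00 Ai0 C0 of_real_def del: sum.lessThan_Suc)
  then have CS: "C $$ (0, Suc j) = - (w * C\<^sub>1 $$ (0, j))" if "j < n" for j
    using solve[of "A $$ (0, Suc j)" "C $$ (0, Suc j)"] that by (simp add: C\<^sub>1_def)
  have "w * B $$ (0, 0) + ?s *\<^sub>R D = 0"
    using mix A B C
    by (simp add: row_mix_def sum.lessThan_Suc_shift A00 Ai0 C0 of_real_def del: sum.lessThan_Suc)
  then have D: "D = - (w * D\<^sub>1)"
    unfolding D\<^sub>1_def by (rule solve)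
  have "A = cascade_A w A\<^sub>1 C\<^sub>1"
    using A casc.carriers s by (intro eq_matI)
      (auto simp: less_Suc_eq_0_disj casc.entries A00 Ai0, auto simp: A\<^sub>1_def C\<^sub>1_def)
  moreover have "B = cascade_B w B\<^sub>1 D\<^sub>1"
    using B casc.carriers s by (intro eq_matI)
      (auto simp: less_Suc_eq_0_disj casc.entries, auto simp: B\<^sub>1_def D\<^sub>1_def)
  moreover have "C = cascade_C w C\<^sub>1"
    using C casc.carriers by (intro eq_matI) (auto simp: less_Suc_eq_0_disj casc.entries C0 CS)
  ultimately show thesis
    using that su D casc.stable_unitary_iff casc.series by metis
qed

lemma blaschke_product_Suc:
  assumes "blaschke_product n f" "norm w < 1"
  shows "blaschke_product (Suc n) (blaschke_factor w * f)"
proof -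
  obtain \<alpha>s \<phi> where "length \<alpha>s = n" "\<forall>\<alpha>\<in>set \<alpha>s. norm \<alpha> < 1" "norm \<phi> = 1"
    "f = prod_list (map blaschke_factor \<alpha>s) * fps_const \<phi>"
    using assms by (auto simp: blaschke_product_def)
  then show ?thesis
    using assms unfolding blaschke_product_def
    by (intro exI[of _ "w # \<alpha>s"] exI[of _ \<phi>]) (simp add: mult.assoc)
qed

text \<open>Scaling an eigenvector \<open>x\<close> from the right conjugates the eigenvalue, so \<open>C x\<close> may be assumed
  to be a nonnegative real.\<close>

lemma normalized_eigenvector:
  fixes A C :: "quat mat"
  assumes A: "A \<in> carrier_mat n n" and C: "C \<in> carrier_mat 1 n" and n: "n > 0"
  obtains x \<alpha> \<gamma> where "x \<in> carrier_vec n" "(\<Sum>i<n. (norm (x $ i))\<^sup>2) = 1"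
    "A *\<^sub>v x = map_vec (\<lambda>t. t * \<alpha>) x" "(C *\<^sub>v x) $ 0 = of_real \<gamma>" "\<gamma> \<ge> 0"
proof -
  obtain y \<beta> where y: "y \<in> carrier_vec n" "y \<noteq> 0\<^sub>v n" and eig: "A *\<^sub>v y = map_vec (\<lambda>t. t * \<beta>) y"
    using right_eigenvector_exists[OF A n] by blast
  define N where "N = (\<Sum>i<n. (norm (y $ i))\<^sup>2)"
  have N: "N > 0"
  proof -
    have "\<exists>i<n. y $ i \<noteq> 0"
      using y by (metis carrier_vecD eq_vecI index_zero_vec)
    then show ?thesis
      unfolding N_def by (auto intro!: sum_pos2)
  qed
  define c where "c = (C *\<^sub>v y) $ 0"
  \<comment> \<open>A unit rotating \<open>c\<close> to its modulus; any unit serves when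
    \<open>c = 0\<close>.\<close>
  define u where "u = (if c = 0 then 1 else qcnj (sgn c))"
  have u: "norm u = 1" "c * u = of_real (norm c)"
  proof -
    show "norm u = 1"
      by (simp add: u_def norm_sgn)
    have "c * qcnj (sgn c) = of_real (norm c)" if "c \<noteq> 0"
      using that by (simp add: sgn_div_norm quat_mult_qcnj of_real_def power2_eq_square)
    then show "c * u = of_real (norm c)"
      by (simp add: u_def)
  qed
  define \<mu> where "\<mu> = u /\<^sub>R sqrt N"
  have \<mu>: "\<mu> \<noteq> 0" "(norm \<mu>)\<^sup>2 = 1 / N"
    using u N by (auto simp: \<mu>_def power_mult_distrib divide_simps)
  define x where "x = map_vec (\<lambda>t. t * \<mu>) y"
  have "(\<Sum>i<n. (norm (x $ i))\<^sup>2) = N * (norm \<mu>)\<^sup>2"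
    using y(1) by (simp add: x_def norm_mult power_mult_distrib N_def sum_distrib_right)
  then have "(\<Sum>i<n. (norm (x $ i))\<^sup>2) = 1"
    using \<mu> N by simp
  moreover have "A *\<^sub>v x = map_vec (\<lambda>t. t * (inverse \<mu> * \<beta> * \<mu>)) x"
    unfolding x_def mult_mat_vec_right_scale[OF A y(1)] eig
    using \<mu>(1) by (intro eq_vecI) (simp_all add: mult.assoc, simp flip: mult.assoc)
  moreover have "(C *\<^sub>v x) $ 0 = of_real (norm c / sqrt N)"
  proof -
    have "(C *\<^sub>v x) $ 0 = c * \<mu>"
      unfolding x_def mult_mat_vec_right_scale[OF C y(1)] c_def using C by simp
    then show ?thesis
      using u by (simp add: \<mu>_def of_real_def divide_inverse mult.commute)
  qed
  ultimately show thesis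
    by (rule that[rotated]) (use y(1) N in \<open>simp_all add: x_def\<close>)
qed

lemma stable_unitary_peel:
  assumes su: "stable_unitary (Suc n) A B C D"
  obtains w A\<^sub>1 B\<^sub>1 C\<^sub>1 D\<^sub>1 where "norm w < 1" "stable_unitary n A\<^sub>1 B\<^sub>1 C\<^sub>1 D\<^sub>1"
    "realization_series A B C D = blaschke_factor w * realization_series A\<^sub>1 B\<^sub>1 C\<^sub>1 D\<^sub>1"
proof -
  have A: "A \<in> carrier_mat (Suc n) (Suc n)" and B: "B \<in> carrier_mat (Suc n) 1" and C: "C \<in> carrier_mat 1 (Suc n)"
    and st: "stable A"
    using su by (simp_all add: stable_unitary_def)
  obtain x \<alpha> \<gamma> where x: "x \<in> carrier_vec (Suc n)" "(\<Sum>i<Suc n. (norm (x $ i))\<^sup>2) = 1"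
    and eig: "A *\<^sub>v x = map_vec (\<lambda>t. t * \<alpha>) x" and \<gamma>: "(C *\<^sub>v x) $ 0 = of_real \<gamma>" "\<gamma> \<ge> 0"
    by (rule normalized_eigenvector[OF A C]) (simp, rule that)
  have "x \<noteq> 0\<^sub>v (Suc n)"
    using x(2) by auto
  \<comment> \<open>Stability puts the zero \<open>qcnj \<alpha>\<close> of the new Blaschke factor
    into the unit ball.\<close>
  then have \<alpha>: "norm \<alpha> < 1"
    using st x eig unfolding stable_iff[OF A] by blast
  obtain V where V: "qunitary (Suc n) V" and V0: "\<And>i. i < Suc n \<Longrightarrow> V $$ (i, 0) = x $ i"
    using qunitary_first_column[OF x(2)] by blast
  have Vc: "V \<in> carrier_mat (Suc n) (Suc n)" and VV: "qadjoint V * V = 1\<^sub>m (Suc n)"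
    using V by (simp_all add: qunitary_def)
  have Va: "qadjoint V \<in> carrier_mat (Suc n) (Suc n)"
    using Vc by simp
  have colV: "col V 0 = x"
    using Vc x V0 by (intro eq_vecI) auto
  define A' B' C' where "A' = qadjoint V * A * V" and "B' = qadjoint V * B" and "C' = C * V"
  have su': "stable_unitary (Suc n) A' B' C' D"
    and series: "realization_series A' B' C' D = realization_series A B C D"
    using stable_unitary_similar[OF su V] by (simp_all only: A'_def B'_def C'_def)
  have carr: "A' \<in> carrier_mat (Suc n) (Suc n)" "B' \<in> carrier_mat (Suc n) 1" "C' \<in> carrier_mat 1 (Suc n)"
    and U': "qunitary (Suc n + 1) (colligation A' B' C' D)"
    using su' by (simp_all add: stable_unitary_def)
  \<comment> \<open>The first column of \<open>V\<close> is the eigenvector \<open>x\<close>, so the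
    first basis vector is an eigenvector of \<open>A'\<close>.\<close>
  have A'0: "A' $$ (i, 0) = (if i = 0 then \<alpha> else 0)" if i: "i < Suc n" for i
  proof -
    have VAc: "qadjoint V * A \<in> carrier_mat (Suc n) (Suc n)"
      by (rule mult_carrier_mat[OF Va A])
    have "A' $$ (i, 0) = ((qadjoint V * A) *\<^sub>v x) $ i"
      unfolding A'_def using i VAc Vc colV by (subst index_mult_mat) auto
    also have "(qadjoint V * A) *\<^sub>v x = qadjoint V *\<^sub>v map_vec (\<lambda>t. t * \<alpha>) x"
      using assoc_mult_mat_vec[OF Va A x(1)] eig by simp
    also have "\<dots> = map_vec (\<lambda>t. t * \<alpha>) (qadjoint V *\<^sub>v x)"
      by (rule mult_mat_vec_right_scale[OF Va x(1)])
    also have "\<dots> $ i = (qadjoint V * V) $$ (i, 0) * \<alpha>"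
      using i Vc colV by simp
    finally show ?thesis
      using i by (simp add: VV)
  qed
  have C'0: "C' $$ (0, 0) = of_real \<gamma>"
    using \<gamma>(1) C Vc colV by (simp add: C'_def)
  \<comment> \<open>The first column has norm 1, which fixes the square of \<gamma>; nonnegativity
    then selects the defect as the root.\<close>
  have "row_gram (qadjoint A') (qadjoint C') 0 0 = 1"
    using U' unfolding qunitary_colligation_iff[OF carr] by auto
  then have "qcnj \<alpha> * \<alpha> + of_real \<gamma> * of_real \<gamma> = 1"
    using carr by (simp add: row_gram_def A'0 C'0 sum.lessThan_Suc_shift del: sum.lessThan_Suc)
  then have "of_real ((norm \<alpha>)\<^sup>2 + \<gamma>\<^sup>2) = (of_real 1 :: quat)"
    by (simp add: qcnj_mult_quat power2_eq_square)
  then have "\<gamma>\<^sup>2 = 1 - (norm \<alpha>)\<^sup>2"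
    by (simp only: of_real_eq_iff)
  then have "defect (qcnj \<alpha>) = \<gamma>"
    using \<gamma>(2) by (simp add: defect_def real_sqrt_unique)
  then have C'0: "C' $$ (0, 0) = of_real (defect (qcnj \<alpha>))"
    using C'0 by simp
  obtain A\<^sub>1 B\<^sub>1 C\<^sub>1 D\<^sub>1 where "stable_unitary n A\<^sub>1 B\<^sub>1 C\<^sub>1 D\<^sub>1"
    "realization_series A' B' C' D = blaschke_factor (qcnj \<alpha>) * realization_series A\<^sub>1 B\<^sub>1 C\<^sub>1 D\<^sub>1"
    by (rule stable_unitary_cascadeE[OF su', of "qcnj \<alpha>"]) (simp_all add: \<alpha> A'0 C'0 that)
  with series \<alpha> show thesis
    using that[of "qcnj \<alpha>"] by simp
qed

section \<open>Unimodular constants and induction on the degree\<close>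

lemma stable_unitary_0_iff:
  assumes A: "A \<in> carrier_mat 0 0" and B: "B \<in> carrier_mat 0 1" and C: "C \<in> carrier_mat 1 0"
  shows "stable_unitary 0 A B C D \<longleftrightarrow> norm D = 1"
proof -
  \<comment> \<open>Vacuous: a space of dimension zero has no nonzero vector.\<close>
  have "stable A"
    unfolding stable_iff[OF A] by auto
  moreover have "(of_real (norm D))\<^sup>2 = (1 :: quat) \<longleftrightarrow> norm D = 1"
  proof -
    have "(of_real (norm D))\<^sup>2 = (1 :: quat) \<longleftrightarrow> (norm D)\<^sup>2 = 1"
      by (metis of_real_1 of_real_eq_iff of_real_power)
    then show ?thesis
      using norm_ge_zero[of D] by (auto simp: power2_eq_1_iff)
  qed
  ultimately show ?thesis
    unfolding stable_unitary_def qunitary_colligation_iff[OF A B C]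
    using A B C by (simp add: row_out_def quat_mult_qcnj qcnj_mult_quat)
qed

lemma realization_series_0:
  assumes A: "A \<in> carrier_mat 0 0" and B: "B \<in> carrier_mat 0 1" and C: "C \<in> carrier_mat 1 0"
  shows "realization_series A B C D = fps_const D"
  by (rule realization_series_eqI[OF assms, symmetric]) simp_all

lemma blaschke_product_realization_series:
  "stable_unitary n A B C D \<Longrightarrow> blaschke_product n (realization_series A B C D)"
proof (induction n arbitrary: A B C D)
  case 0
  then have carr: "A \<in> carrier_mat 0 0" "B \<in> carrier_mat 0 1" "C \<in> carrier_mat 1 0"
    by (simp_all add: stable_unitary_def)
  with 0 show ?case
    by (auto simp: stable_unitary_0_iff[OF carr] realization_series_0[OF carr] blaschke_product_def)
next
  case (Suc n)
  show ?case
    by (rule stable_unitary_peel[OF Suc.prems]) (simp add: blaschke_product_Suc Suc.IH)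
qed

text \<open>The constant \<phi> is realized with empty state space, and each factor adds one state
  by a cascade, so the state dimension is the number of factors.\<close>

lemma blaschke_product_realizable:
  assumes "blaschke_product n f"
  obtains A B C D where "stable_unitary n A B C D" "f = realization_series A B C D"
proof -
  obtain \<alpha>s \<phi> where len: "length \<alpha>s = n" and \<alpha>s: "\<forall>\<alpha>\<in>set \<alpha>s. norm \<alpha> < 1" and \<phi>: "norm \<phi> = 1"
    and f: "f = prod_list (map blaschke_factor \<alpha>s) * fps_const \<phi>"
    using assms by (auto simp: blaschke_product_def)
  have "\<exists>A B C D. stable_unitary (length \<alpha>s) A B C D \<and>
      prod_list (map blaschke_factor \<alpha>s) * fps_const \<phi> = realization_series A B C D"
    using \<alpha>s
  proof (induction \<alpha>s)
    case Nil
    have carr: "0\<^sub>m 0 0 \<in> carrier_mat 0 0" "0\<^sub>m 0 1 \<in> carrier_mat 0 1" "0\<^sub>m 1 0 \<in> carrier_mat 1 0"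
      by simp_all
    show ?case
      using stable_unitary_0_iff[OF carr, of \<phi>] realization_series_0[OF carr, of \<phi>] \<phi>
      by (metis list.size(3) list.map(1) prod_list.Nil mult_1)
  next
    case (Cons w ws)
    then obtain A B C D where IH: "stable_unitary (length ws) A B C D"
      "prod_list (map blaschke_factor ws) * fps_const \<phi> = realization_series A B C D"
      by auto
    interpret casc: cascade "length ws" A B C D w
      using IH(1) Cons.prems by unfold_locales (simp_all add: stable_unitary_def)
    show ?case
      using IH casc.stable_unitary_iff casc.series by (simp add: mult.assoc) metis
  qed
  with len f that show thesis
    by auto
qed

theorem theorem3p11:
  shows "(\<forall>n A B C D. stable_unitary n A B C D \<longrightarrow>
            realization_fun A B C D = realization_series A B C D \<and>
            blaschke_product n (realization_fun A B C D)) \<and>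
         (\<forall>f. (\<exists>n. blaschke_product n f) \<longrightarrow>
            (\<exists>m A B C D. stable_unitary m A B C D \<and> f = realization_fun A B C D))"
proof -
  have fun_eq: "realization_fun A B C D = realization_series A B C D" if "stable_unitary n A B C D" for n A B C D
    using that by (intro realization_fun_eq_series[of _ n]) (simp_all add: stable_unitary_def)
  have "\<exists>m A B C D. stable_unitary m A B C D \<and> f = realization_fun A B C D" if "blaschke_product n f" for n f
    using blaschke_product_realizable[OF that] fun_eq by metis
  then show ?thesis
    using fun_eq blaschke_product_realization_series by auto
qed

end
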